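(* Let $G$ be a graph of order $n$ whose complement has at least three connected components. Then $Q(G)>1$. When $n\ge16$, we have $$Q(G)\ge\frac{27}{n^2}\left(\frac32\right)^{n-4}.$$
   Context: All graphs are finite and simple; the order of a graph is its number of vertices. For a graph $G$, $\alpha(G)$ is the number of acyclic orientations of $G$ and $\alpha^{*}(G)$ is the number of totally cyclic orientations of $G$ (orientations in which every edge lies on a directed cycle). For a connected graph $G$, $\tau(G)$ is the number of spanning trees of $G$. For connected $G$, define $Q(G)=\alpha(G)\alpha^{*}(G)/\tau(G)^2$. (A graph has a complement with at least three components if and only if it is a join of at least three graphs with nonempty vertex sets, where the join of graphs is obtained from their disjoint union by adding all edges between different factors; in particular such a graph is connected.) *)

theory Defs
  imports Complex_Main "Graph_Theory.Digraph_Component"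
begin

text \<open>
  A finite simple graph is a \<^locale>\<open>pair_graph\<close>: a finite, loop-free digraph given by a symmetric
  arc relation, so that an undirected edge \<open>uv\<close> is the pair of arcs \<open>(u, v)\<close>, \<open>(v, u)\<close>.
\<close>

definition complement_graph :: "'a pair_pre_digraph \<Rightarrow> 'a pair_pre_digraph" where
  "complement_graph G = \<lparr> pverts = pverts G,
     parcs = {(u, v). u \<in> pverts G \<and> v \<in> pverts G \<and> u \<noteq> v \<and> (u, v) \<notin> parcs G} \<rparr>"

text \<open>In a symmetric digraph, the strongly connected components are the connected components.\<close>

definition num_components :: "'a pair_pre_digraph \<Rightarrow> nat" where
  "num_components G = card (pre_digraph.sccs (with_proj G))"

definition orientation :: "'a pair_pre_digraph \<Rightarrow> 'a pair_pre_digraph \<Rightarrow> bool" where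
  "orientation D G \<longleftrightarrow> pverts D = pverts G \<and>
     parcs D \<union> (parcs D)\<inverse> = parcs G \<and> parcs D \<inter> (parcs D)\<inverse> = {}"

definition acyclic_orientation :: "'a pair_pre_digraph \<Rightarrow> 'a pair_pre_digraph \<Rightarrow> bool" where
  "acyclic_orientation D G \<longleftrightarrow> orientation D G \<and> (\<nexists>p. pre_digraph.cycle (with_proj D) p)"

definition totally_cyclic_orientation :: "'a pair_pre_digraph \<Rightarrow> 'a pair_pre_digraph \<Rightarrow> bool" where
  "totally_cyclic_orientation D G \<longleftrightarrow> orientation D G \<and>
     (\<forall>e \<in> parcs D. \<exists>p. pre_digraph.cycle (with_proj D) p \<and> e \<in> set p)"

text \<open>
  The constants \<^const>\<open>tree\<close> and \<^const>\<open>spanning_tree\<close> forbid directed cycles, and a symmetric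
  digraph with an edge always contains the directed 2-cycle \<open>(u, v), (v, u)\<close>. The cycles of an
  undirected simple graph are the directed cycles of length at least 3 of its symmetric digraph.
\<close>

definition undirected_tree :: "'a pair_pre_digraph \<Rightarrow> bool" where
  "undirected_tree T \<longleftrightarrow> pair_graph T \<and> connected (with_proj T) \<and>
     (\<nexists>p. pre_digraph.cycle (with_proj T) p \<and> length p \<ge> 3)"

definition undirected_spanning_tree :: "'a pair_pre_digraph \<Rightarrow> 'a pair_pre_digraph \<Rightarrow> bool" where
  "undirected_spanning_tree T G \<longleftrightarrow> undirected_tree T \<and> spanning (with_proj T) (with_proj G)"

definition num_acyclic_orientations :: "'a pair_pre_digraph \<Rightarrow> nat" where
  "num_acyclic_orientations G = card {D. acyclic_orientation D G}"

definition num_totally_cyclic_orientations :: "'a pair_pre_digraph \<Rightarrow> nat" where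
  "num_totally_cyclic_orientations G = card {D. totally_cyclic_orientation D G}"

definition num_spanning_trees :: "'a pair_pre_digraph \<Rightarrow> nat" where
  "num_spanning_trees G = card {T. undirected_spanning_tree T G}"

text \<open>Meaningful for connected graphs only; otherwise there is no spanning tree and the value is 0.\<close>

definition Q :: "'a pair_pre_digraph \<Rightarrow> real" where
  "Q G = real (num_acyclic_orientations G) * real (num_totally_cyclic_orientations G)
           / (real (num_spanning_trees G))\<^sup>2"

end

theory Submission
  imports Defs "HOL-Library.FuncSet"
begin

text \<open>
A graph whose complement has at least three components is a join of three nonempty graphs on vertex
sets \<open>A\<close>, \<open>B\<close>, \<open>C\<close> of sizes \<open>a\<close>, \<open>b\<close>, \<open>c\<close>; let \<open>n = a + b + c\<close>. The proof deletes one vertex \<open>v\<close> of a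
largest part, say \<open>A\<close>, and compares the three counts before and after. Let \<open>d = b + c + e\<close> be the degree
of \<open>v\<close>, where \<open>e\<close> is the number of its neighbours in \<open>A\<close>.

\<^item> An acyclic orientation of \<open>G - v\<close> lists the neighbours of \<open>v\<close> in some linear order, and \<open>v\<close> can be
  inserted at \<open>d + 1\<close> places of it: \<open>\<alpha>(G) \<ge> (d + 1) \<alpha>(G - v)\<close> (\<open>card_ranked_delete\<close>).
\<^item> A strongly connected orientation of \<open>G - v\<close> stays strongly connected whenever \<open>v\<close> gets both an
  incoming and an outgoing arc: \<open>\<alpha>\<^sup>*(G) \<ge> (2\<^sup>d - 2) \<alpha>\<^sup>*(G - v)\<close> (\<open>card_strong_delete\<close>).
\<^item> Let \<open>F\<^sub>X(y)\<close> count the rooted spanning forests of \<open>G[X]\<close>, each root having weight \<open>y\<close>; this is the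
  determinant of \<open>y I + L\<close> for the Laplacian \<open>L\<close> of \<open>G[X]\<close>. With \<open>t\<^sub>X(y) = F\<^sub>X(y) / y\<close>, the join
  satisfies \<open>\<tau>(G) \<le> n t\<^sub>A(n - a) t\<^sub>B(n - b) t\<^sub>C(n - c)\<close>. This
  follows from a generalised Cayley formula (\<open>forest_sum_shift\<close>): raising the weight of all arcs into
  each vertex by a constant has the same effect as raising the root weight. Lowering all arcs of the
  join by 1 makes the arcs between different parts vanish, the forest count factors, and raising the
  arcs inside each part again gives the formula (\<open>forest_sum_join3\<close>).

Deleting \<open>v\<close> changes this bound on \<open>\<tau>\<close> by at most the factor \<open>\<phi> \<psi> n / (n - 1)\<close>. Here \<open>\<phi>\<close> bounds the change of
\<open>F\<^sub>A\<close> (\<open>forest_sum_add_vertex\<close>) and \<open>\<psi>\<close> the change of \<open>t\<^sub>B\<close> and \<open>t\<^sub>C\<close>, whose arguments drop by 1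
(\<open>block_step\<close>). The claimed bound \<open>beta n = (27 / n\<^sup>2) (3 / 2) ^ (n - 4)\<close> grows by the factor
\<open>(3 / 2) ((n - 1) / n)\<^sup>2\<close> from \<open>n - 1\<close> to \<open>n\<close>, so a step is good enough as soon as
\<open>(3 / 2) (\<phi> \<psi>)\<^sup>2 \<le> (d + 1) (2\<^sup>d - 2)\<close>.

If \<open>b = c = 1\<close>, then \<open>\<psi> = 1\<close> and the inequality holds when \<open>v\<close> has minimum degree in \<open>G[A]\<close>; it is an
equality for \<open>e = 0\<close> and \<open>e = 1\<close>. The induction starts at four vertices, where the graph \<open>K\<^sub>4\<close> minus an
edge has \<open>Q = 27 / 16 = beta 4\<close>. In all other cases any vertex \<open>v\<close> of a largest part will do, but the
inequality fails slightly for some small graphs such as \<open>K\<^sub>1\<^sub>,\<^sub>2\<^sub>,\<^sub>2\<close>. The factor \<open>kappa n\<close> records this loss: it is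
below 1 only for \<open>5 \<le> n \<le> 9\<close>, because larger steps have room to spare, and \<open>kappa n * beta n > 1\<close>
throughout. Hence \<open>Q G \<ge> kappa n * beta n\<close> for all \<open>n \<ge> 4\<close>, which gives both claims; the triangle is
treated separately.
\<close>

section \<open>Weighted rooted forests\<close>

text \<open>
A rooted forest on \<open>U\<close> is coded by its parent function, a root being its own parent. The rank \<open>h\<close>
excludes all other cycles; unlike a condition on iterates, it is easy to adapt when a function is changed.
\<close>

definition forests :: "'a set \<Rightarrow> ('a \<Rightarrow> 'a) set" where
  "forests U = {f \<in> U \<rightarrow>\<^sub>E U. \<exists>h::'a \<Rightarrow> nat. \<forall>x\<in>U. f x \<noteq> x \<longrightarrow> h (f x) < h x}"

text \<open>
The diagonal entries of \<open>m\<close> are the root weights. By the matrix-tree theorem this is the determinant of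
the matrix with off-diagonal entries \<open>- m x y\<close> and row sums \<open>m x x\<close>.
\<close>

definition forest_sum :: "'a set \<Rightarrow> ('a \<Rightarrow> 'a \<Rightarrow> real) \<Rightarrow> real" where
  "forest_sum U m = (\<Sum>f\<in>forests U. \<Prod>x\<in>U. m x (f x))"

text \<open>
Deleting a vertex \<open>u\<close> whose parent is \<open>w\<close> turns the children of \<open>u\<close> into children of \<open>w\<close>, and
deleting a root \<open>u\<close> (the case \<open>w = u\<close>) turns them into roots. Accordingly \<open>absorb\<close> moves the weights of
the arcs into \<open>u\<close> to the new targets. Since \<open>w\<close> cannot be a child of its own child \<open>u\<close>, row \<open>w\<close> is left
unchanged.
\<close>

definition absorb :: "'a \<Rightarrow> 'a \<Rightarrow> ('a \<Rightarrow> 'a \<Rightarrow> real) \<Rightarrow> 'a \<Rightarrow> 'a \<Rightarrow> real" where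
  "absorb u w m x y =
     m x y + (if x \<noteq> w \<and> y = (if w = u then x else w) then m x u else 0)"

lemma finite_forests: "finite U \<Longrightarrow> finite (forests U)"
  unfolding forests_def by (rule finite_subset[of _ "U \<rightarrow>\<^sub>E U"]) (auto intro: finite_PiE)

lemma forestsE:
  assumes "f \<in> forests U"
  obtains h :: "'a \<Rightarrow> nat" where "f \<in> U \<rightarrow>\<^sub>E U" "\<And>x. x \<in> U \<Longrightarrow> f x \<noteq> x \<Longrightarrow> h (f x) < h x"
  using assms unfolding forests_def by blast

lemma forestsI:
  fixes h :: "'a \<Rightarrow> nat"
  assumes "f \<in> U \<rightarrow>\<^sub>E U" "\<And>x. x \<in> U \<Longrightarrow> f x \<noteq> x \<Longrightarrow> h (f x) < h x"
  shows "f \<in> forests U"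
  using assms unfolding forests_def by blast

lemma forest_sum_empty [simp]: "forest_sum {} m = 1"
proof -
  have "forests {} = {\<lambda>x::'a. undefined}" unfolding forests_def by auto
  then show ?thesis unfolding forest_sum_def by simp
qed

lemma forest_sum_cong:
  assumes "\<And>x y. x \<in> U \<Longrightarrow> y \<in> U \<Longrightarrow> m x y = m' x y"
  shows "forest_sum U m = forest_sum U m'"
  unfolding forest_sum_def
  by (intro sum.cong prod.cong refl) (auto simp: forests_def intro: assms)

text \<open>
Expansion along row \<open>u\<close>. For a fixed parent \<open>w\<close> of \<open>u\<close>, redirecting the children of \<open>u\<close> maps the forests
on \<open>U\<close> to forests on \<open>U - {u}\<close>; a fibre of this map consists of free choices, for each \<open>x\<close> now attached
to the new target, whether \<open>x\<close> was a child of \<open>u\<close>. Multiplying out the entries of \<open>absorb u w m\<close> produces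
the same choices.
\<close>

lemma forest_sum_expand:
  assumes fin: "finite U" and u: "u \<in> U"
  shows "forest_sum U m = (\<Sum>w\<in>U. m u w * forest_sum (U - {u}) (absorb u w m))"
proof -
  let ?V = "U - {u}"
  have part: "forest_sum U m = (\<Sum>w\<in>U. \<Sum>f\<in>{f \<in> forests U. f u = w}. \<Prod>x\<in>U. m x (f x))"
    unfolding forest_sum_def
    by (rule sum.group[symmetric], use fin u in \<open>auto simp: finite_forests\<close>)
      (auto simp: forests_def)
  have "(\<Sum>f\<in>{f \<in> forests U. f u = w}. \<Prod>x\<in>U. m x (f x)) =
        m u w * forest_sum ?V (absorb u w m)" if w: "w \<in> U" for w
  proof -
    define tgt where "tgt x = (if w = u then x else w)" for x
    define B where "B g x = (if x \<noteq> w \<and> g x = tgt x then {g x, u} else {g x})" for g x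
    have finB: "finite (B g x)" for g x unfolding B_def by simp
    define red where "red f = restrict (\<lambda>x. if f x = u then tgt x else f x) ?V" for f
    have "forest_sum ?V (absorb u w m) =
          (\<Sum>g\<in>forests ?V. \<Prod>x\<in>?V. \<Sum>y\<in>B g x. m x y)"
      unfolding forest_sum_def
    proof (intro sum.cong prod.cong refl)
      fix g x assume "g \<in> forests ?V" "x \<in> ?V"
      then have "g x \<noteq> u" by (auto simp: forests_def)
      then show "absorb u w m x (g x) = (\<Sum>y\<in>B g x. m x y)"
        by (auto simp: absorb_def B_def tgt_def)
    qed
    also have "\<dots> = (\<Sum>g\<in>forests ?V. \<Sum>k\<in>PiE ?V (B g). \<Prod>x\<in>?V. m x (k x))"
      by (intro sum.cong refl prod_sum_PiE) (use fin finB in auto)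
    also have "\<dots> = (\<Sum>(g, k)\<in>Sigma (forests ?V) (\<lambda>g. PiE ?V (B g)). \<Prod>x\<in>?V. m x (k x))"
      by (rule sum.Sigma) (use fin finB in \<open>auto simp: finite_forests intro!: finite_PiE\<close>)
    also have "\<dots> = (\<Sum>f\<in>{f \<in> forests U. f u = w}. \<Prod>x\<in>?V. m x (f x))"
    proof (rule sum.reindex_bij_witness[where
          i = "\<lambda>f. (red f, restrict f ?V)" and j = "\<lambda>(g, k). k(u := w)"], goal_cases)
      case (1 a)
      then obtain g k where a: "a = (g, k)" and g: "g \<in> forests ?V" and k: "k \<in> PiE ?V (B g)"
        by (rule SigmaE)
      have ku: "k \<in> extensional ?V" using k unfolding PiE_def by blast
      have kB: "k x \<in> B g x" if "x \<in> ?V" for x by (rule PiE_mem[OF k that])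
      have "restrict (k(u := w)) ?V = k" using ku by (auto simp: restrict_def extensional_def)
      moreover have "red (k(u := w)) = g"
      proof
        fix x show "red (k(u := w)) x = g x"
        proof (cases "x \<in> ?V")
          case True
          then have "g x \<noteq> u" using g by (auto simp: forests_def)
          then show ?thesis using kB[OF True] True by (auto simp: red_def B_def split: if_splits)
        next
          case False
          then have "g x = undefined" using g by (auto simp: forests_def PiE_def extensional_def)
          then show ?thesis using False unfolding red_def restrict_def by auto
        qed
      qed
      ultimately show ?case using a by simp
    next
      case (2 a)
      then obtain g k where a: "a = (g, k)" and g: "g \<in> forests ?V" and k: "k \<in> PiE ?V (B g)"
        by (rule SigmaE)
      from g obtain h :: "'a \<Rightarrow> nat" where gV: "g \<in> ?V \<rightarrow>\<^sub>E ?V"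
        and h: "\<And>x. x \<in> ?V \<Longrightarrow> g x \<noteq> x \<Longrightarrow> h (g x) < h x" by (rule forestsE) blast
      have ku: "k \<in> extensional ?V" using k unfolding PiE_def by blast
      have kB: "k x \<in> B g x" if "x \<in> ?V" for x by (rule PiE_mem[OF k that])
      have kU: "k x \<in> U" if "x \<in> ?V" for x
      proof -
        have "g x \<in> U" using gV that by auto
        then show ?thesis using kB[OF that] u by (auto simp: B_def split: if_splits)
      qed
      have "k(u := w) \<in> forests U"
      \<comment> \<open>Odd ranks leave room for \<open>u\<close> strictly between \<open>w\<close> and the vertices above \<open>w\<close>.\<close>
      proof (rule forestsI[where h = "\<lambda>x. if x = u then (if w = u then 0 else 2 * h w + 2)
                                            else 2 * h x + 1"])
        show "k(u := w) \<in> U \<rightarrow>\<^sub>E U"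
          using ku kU w u by (intro PiE_I) (auto simp: extensional_def)
        fix x assume x: "x \<in> U" "(k(u := w)) x \<noteq> x"
        show "(if (k(u := w)) x = u then (if w = u then 0 else 2 * h w + 2)
                 else 2 * h ((k(u := w)) x) + 1)
              < (if x = u then (if w = u then 0 else 2 * h w + 2) else 2 * h x + 1)"
        proof (cases "x = u")
          case True then show ?thesis using x by auto
        next
          case False
          then have xV: "x \<in> ?V" using x by auto
          show ?thesis
          proof (cases "k x = u")
            case True
            then have "x \<noteq> w" "g x = tgt x"
              using kB[OF xV] gV xV by (auto simp: B_def split: if_splits)
            then show ?thesis using h[OF xV] False True by (auto simp: tgt_def)
          next
            case kx: False
            then have "k x = g x" using kB[OF xV] by (auto simp: B_def split: if_splits)
            then show ?thesis using h[OF xV] False kx x by auto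
          qed
        qed
      qed
      then show ?case using a by simp
    next
      case (3 f)
      then have f: "f u = w" "f \<in> extensional U" unfolding forests_def PiE_def by blast+
      have "(restrict f ?V)(u := w) = f"
      proof
        fix x show "((restrict f ?V)(u := w)) x = f x"
          using f by (cases "x \<in> U") (auto simp: extensional_def)
      qed
      then show ?case by simp
    next
      case (4 f)
      then have fw: "f u = w" and fU: "f \<in> U \<rightarrow>\<^sub>E U" by (auto simp: forests_def)
      from 4 obtain h :: "'a \<Rightarrow> nat" where
        h: "\<And>x. x \<in> U \<Longrightarrow> f x \<noteq> x \<Longrightarrow> h (f x) < h x" by (auto simp: forests_def)
      have nxw: "x \<noteq> w" if "x \<in> ?V" "f x = u" for x
        using h[of x] h[of u] that fw u by auto
      have "red f \<in> forests ?V"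
      proof (rule forestsI[where h = h])
        show "red f \<in> ?V \<rightarrow>\<^sub>E ?V"
          using PiE_mem[OF fU] w unfolding red_def tgt_def by (intro restrict_PiE_iff[THEN iffD2]) auto
        fix x assume x: "x \<in> ?V" "red f x \<noteq> x"
        show "h (red f x) < h x"
        proof (cases "f x = u")
          case True
          then have "w \<noteq> u" "red f x = w" using x by (auto simp: red_def tgt_def split: if_splits)
          then show ?thesis using h[of x] h[of u] x True fw u by auto
        next
          case False
          then show ?thesis using h[of x] x unfolding red_def restrict_def by auto
        qed
      qed
      moreover have "restrict f ?V \<in> PiE ?V (B (red f))"
      proof (rule PiE_I)
        fix x assume x: "x \<in> ?V"
        then have "red f x = (if f x = u then tgt x else f x)" unfolding red_def by (rule restrict_apply')
        then show "restrict f ?V x \<in> B (red f) x"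
          using x nxw[OF x] unfolding B_def by (cases "f x = u") simp_all
      qed auto
      ultimately show ?case by simp
    next
      case (5 a)
      then obtain g k where a: "a = (g, k)" by (rule SigmaE)
      show ?case unfolding a prod.case by (intro prod.cong refl) simp
    qed
    also have "m u w * \<dots> = (\<Sum>f\<in>{f \<in> forests U. f u = w}. \<Prod>x\<in>U. m x (f x))"
      unfolding sum_distrib_left
      by (intro sum.cong refl) (use fin u in \<open>auto simp: prod.remove[of U u]\<close>)
    finally show ?thesis by simp
  qed
  then show ?thesis unfolding part by simp
qed

text \<open>
The coefficient of \<open>m x w\<close> in \<open>forest_sum U m\<close>.
\<close>

definition cofactor :: "'a set \<Rightarrow> ('a \<Rightarrow> 'a \<Rightarrow> real) \<Rightarrow> 'a \<Rightarrow> 'a \<Rightarrow> real" where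
  "cofactor U m x w = (\<Sum>f\<in>{f \<in> forests U. f x = w}. \<Prod>y\<in>U - {x}. m y (f y))"

lemma forest_sum_cofactor:
  assumes fin: "finite U" and u: "u \<in> U"
  shows "forest_sum U m = (\<Sum>w\<in>U. m u w * cofactor U m u w)"
proof -
  have "forest_sum U m = (\<Sum>w\<in>U. \<Sum>f\<in>{f \<in> forests U. f u = w}. \<Prod>x\<in>U. m x (f x))"
    unfolding forest_sum_def
    by (rule sum.group[symmetric], use fin u in \<open>auto simp: finite_forests\<close>)
      (auto simp: forests_def)
  also have "\<dots> = (\<Sum>w\<in>U. m u w * cofactor U m u w)"
    unfolding cofactor_def sum_distrib_left
    by (intro sum.cong refl) (use fin u in \<open>auto simp: prod.remove[of U u]\<close>)
  finally show ?thesis .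
qed

lemma cofactor_cong:
  assumes "\<And>y z. y \<in> U \<Longrightarrow> y \<noteq> x \<Longrightarrow> m y z = m' y z"
  shows "cofactor U m x w = cofactor U m' x w"
  unfolding cofactor_def by (intro sum.cong prod.cong refl) (auto intro: assms)

lemma cofactor_nonneg:
  assumes "\<And>y z. y \<in> U \<Longrightarrow> z \<in> U \<Longrightarrow> 0 \<le> m y z"
  shows "0 \<le> cofactor U m x w"
  unfolding cofactor_def
  by (intro sum_nonneg prod_nonneg) (auto intro!: assms simp: forests_def)

lemma forest_sum_nonneg:
  assumes "\<And>y z. y \<in> U \<Longrightarrow> z \<in> U \<Longrightarrow> 0 \<le> m y z"
  shows "0 \<le> forest_sum U m"
  unfolding forest_sum_def
  by (intro sum_nonneg prod_nonneg) (auto intro!: assms simp: forests_def)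

text \<open>
Cutting the arc from \<open>x\<close> to its parent makes \<open>x\<close> a root and leaves a forest.
\<close>

lemma cofactor_le_root:
  assumes fin: "finite U" and x: "x \<in> U" and nn: "\<And>y z. y \<in> U \<Longrightarrow> z \<in> U \<Longrightarrow> 0 \<le> m y z"
  shows "cofactor U m x w \<le> cofactor U m x x"
proof -
  let ?W = "\<lambda>f. \<Prod>y\<in>U - {x}. m y (f y)"
  let ?F = "{f \<in> forests U. f x = w}"
  let ?r = "\<lambda>f. f(x := x)"
  have inj: "inj_on ?r ?F"
  proof (rule inj_onI)
    fix f g assume "f \<in> ?F" "g \<in> ?F" and e: "f(x := x) = g(x := x)"
    then have "f x = g x" by simp
    then show "f = g" using fun_cong[OF e] by (metis fun_upd_other ext)
  qed
  have "cofactor U m x w = sum ?W (?r ` ?F)"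
    unfolding cofactor_def sum.reindex[OF inj] by (auto intro!: sum.cong prod.cong)
  also have "\<dots> \<le> cofactor U m x x"
    unfolding cofactor_def
  proof (rule sum_mono2)
    show "finite {f \<in> forests U. f x = x}" using fin by (simp add: finite_forests)
    show "?r ` ?F \<subseteq> {f \<in> forests U. f x = x}"
    proof safe
      fix f assume "f \<in> forests U"
      then obtain h :: "'a \<Rightarrow> nat" where "f \<in> U \<rightarrow>\<^sub>E U"
        "\<And>y. y \<in> U \<Longrightarrow> f y \<noteq> y \<Longrightarrow> h (f y) < h y" by (rule forestsE) blast
      then show "f(x := x) \<in> forests U"
        using x by (intro forestsI[where h = h]) (auto simp: PiE_def extensional_def)
    qed auto
  qed (auto intro!: prod_nonneg nn simp: forests_def)
  finally show ?thesis .
qed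

text \<open>
Forests in which the vertices of \<open>S\<close> are forced to be roots, of weight 1.
\<close>

definition root_rows :: "'a set \<Rightarrow> ('a \<Rightarrow> 'a \<Rightarrow> real) \<Rightarrow> 'a \<Rightarrow> 'a \<Rightarrow> real" where
  "root_rows S m x y = (if x \<in> S then of_bool (x = y) else m x y)"

definition bump :: "'a set \<Rightarrow> ('a \<Rightarrow> 'a) \<Rightarrow> ('a \<Rightarrow> 'a \<Rightarrow> real) \<Rightarrow> 'a \<Rightarrow> 'a \<Rightarrow> real" where
  "bump N c m x y = m x y + of_bool (x \<in> N \<and> y = c x)"

lemma forest_sum_unit_row:
  assumes fin: "finite U" and x: "x \<in> U" and w: "w \<in> U"
    and row: "\<And>y. y \<in> U \<Longrightarrow> m x y = of_bool (y = w)"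
  shows "forest_sum U m = cofactor U m x w"
proof -
  have "forest_sum U m = (\<Sum>y\<in>U. of_bool (y = w) * cofactor U m x y)"
    unfolding forest_sum_cofactor[OF fin x] by (intro sum.cong refl) (simp add: row)
  also have "\<dots> = (\<Sum>y\<in>U. if y = w then cofactor U m x y else 0)"
    by (intro sum.cong) auto
  also have "\<dots> = cofactor U m x w" using fin w by simp
  finally show ?thesis .
qed

lemma forest_sum_bump_insert:
  assumes fin: "finite U" and x: "x \<in> U" "x \<notin> N" and c: "c x \<in> U"
  shows "forest_sum U (bump (insert x N) c m) =
         forest_sum U (bump N c m) + cofactor U (bump N c m) x (c x)"
proof -
  have cof: "cofactor U (bump (insert x N) c m) x w = cofactor U (bump N c m) x w" for w
    by (rule cofactor_cong) (simp add: bump_def)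
  have "forest_sum U (bump (insert x N) c m) =
     (\<Sum>w\<in>U. bump N c m x w * cofactor U (bump N c m) x w
            + (if w = c x then cofactor U (bump N c m) x w else 0))"
    unfolding forest_sum_cofactor[OF fin x(1)] cof
    by (intro sum.cong refl) (use x in \<open>auto simp: bump_def algebra_simps\<close>)
  also have "\<dots> = forest_sum U (bump N c m) + cofactor U (bump N c m) x (c x)"
    unfolding sum.distrib forest_sum_cofactor[OF fin x(1), symmetric] using fin c by simp
  finally show ?thesis .
qed

text \<open>
Raising an entry of row \<open>x\<close> by 1 adds a cofactor, which is largest on the diagonal, where it counts the
forests with root \<open>x\<close>. If those are at most an \<open>r\<close>-th part of all, each raised row costs a factor
\<open>1 + r\<close>. The set \<open>S\<close> in the hypothesis collects the rows that earlier steps have already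
turned into roots.
\<close>

lemma forest_sum_bump_le:
  assumes fin: "finite U" and NU: "N \<subseteq> U" and c: "\<And>x. x \<in> N \<Longrightarrow> c x \<in> U"
    and nn: "\<And>y z. y \<in> U \<Longrightarrow> z \<in> U \<Longrightarrow> 0 \<le> m y z" and r: "0 \<le> r"
    and root: "\<And>S x. S \<subseteq> N \<Longrightarrow> x \<in> N - S \<Longrightarrow>
       forest_sum U (root_rows (insert x S) m) \<le> r * forest_sum U (root_rows S m)"
  shows "forest_sum U (bump N c m) \<le> (1 + r) ^ card N * forest_sum U m"
proof -
  have finN: "finite N" using fin NU by (rule finite_subset[rotated])
  have "forest_sum U (bump M c (root_rows S m)) \<le> (1 + r) ^ card M * forest_sum U (root_rows S m)"
    if "M \<subseteq> N" "S \<subseteq> N" "S \<inter> M = {}" for M S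
    using finite_subset[OF that(1) finN] that
  proof (induction M arbitrary: S rule: finite_induct)
    case empty
    have "bump {} c (root_rows S m) = root_rows S m" by (intro ext) (simp add: bump_def)
    then show ?case by simp
  next
    case (insert x M)
    let ?b = "\<lambda>S. bump M c (root_rows S m)"
    have xU: "x \<in> U" and xN: "x \<in> N" and xS: "x \<notin> S" using insert.prems NU by auto
    have nnb: "0 \<le> ?b S y z" if "y \<in> U" "z \<in> U" for y z
      using nn[OF that] by (simp add: bump_def root_rows_def)
    have "cofactor U (?b S) x (c x) \<le> cofactor U (?b S) x x"
      by (rule cofactor_le_root[OF fin xU nnb])
    also have "\<dots> = cofactor U (?b (insert x S)) x x"
      by (rule cofactor_cong) (simp add: bump_def root_rows_def)
    also have "\<dots> = forest_sum U (?b (insert x S))"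
      by (rule forest_sum_unit_row[symmetric, OF fin xU xU])
        (use insert.hyps in \<open>auto simp: bump_def root_rows_def\<close>)
    also have "\<dots> \<le> (1 + r) ^ card M * forest_sum U (root_rows (insert x S) m)"
      using insert.prems insert.hyps by (intro insert.IH) auto
    also have "\<dots> \<le> (1 + r) ^ card M * (r * forest_sum U (root_rows S m))"
      using r insert.prems xN xS by (intro mult_left_mono root) auto
    finally have "cofactor U (?b S) x (c x) \<le> (1 + r) ^ card M * (r * forest_sum U (root_rows S m))" .
    moreover have "forest_sum U (?b S) \<le> (1 + r) ^ card M * forest_sum U (root_rows S m)"
      using insert.prems by (intro insert.IH) auto
    ultimately have "forest_sum U (?b S) + cofactor U (?b S) x (c x)
        \<le> (1 + r) ^ card M * forest_sum U (root_rows S m)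
          + (1 + r) ^ card M * (r * forest_sum U (root_rows S m))" by simp
    also have "\<dots> = (1 + r) ^ card (insert x M) * forest_sum U (root_rows S m)"
      using insert.hyps by (simp add: algebra_simps)
    finally show ?case
      using forest_sum_bump_insert[OF fin xU insert.hyps(2), of c "root_rows S m"] c[OF xN] by simp
  qed
  moreover have "root_rows {} m = m" by (intro ext) (simp add: root_rows_def)
  ultimately show ?thesis by (metis Int_empty_left empty_subsetI order_refl)
qed

section \<open>A shift identity and the forests of a join\<close>

definition rooted :: "real \<Rightarrow> ('a \<Rightarrow> 'a \<Rightarrow> real) \<Rightarrow> 'a \<Rightarrow> 'a \<Rightarrow> real" where
  "rooted z a x y = (if x = y then z else a x y)"

lemma forest_sum_change_entry:
  assumes fin: "finite U" and u: "u \<in> U" and w: "w \<in> U"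
    and same: "\<And>x y. x \<in> U \<Longrightarrow> y \<in> U \<Longrightarrow> (x, y) \<noteq> (u, w) \<Longrightarrow> m' x y = m x y"
  shows "forest_sum U m' = forest_sum U m
           + (m' u w - m u w) * forest_sum (U - {u}) (absorb u w m)"
proof -
  have eq: "forest_sum (U - {u}) (absorb u v m') = forest_sum (U - {u}) (absorb u v m)" for v
    by (rule forest_sum_cong) (use u same in \<open>auto simp: absorb_def\<close>)
  have "forest_sum U m' = m' u w * forest_sum (U - {u}) (absorb u w m)
      + (\<Sum>v\<in>U - {w}. m u v * forest_sum (U - {u}) (absorb u v m))"
    unfolding forest_sum_expand[OF fin u] eq using fin w u same
    by (subst sum.remove[OF fin w]) auto
  moreover have "forest_sum U m = m u w * forest_sum (U - {u}) (absorb u w m)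
      + (\<Sum>v\<in>U - {w}. m u v * forest_sum (U - {u}) (absorb u v m))"
    unfolding forest_sum_expand[OF fin u] by (subst sum.remove[OF fin w]) auto
  ultimately show ?thesis by (simp add: algebra_simps)
qed

lemma forest_sum_absorb_rooted:
  assumes "w \<noteq> u"
  shows "forest_sum (U - {u}) (absorb u w (rooted z a)) =
         forest_sum (U - {u}) (rooted z (\<lambda>x y. a x y + (if y = w then a x u else 0)))"
  by (rule forest_sum_cong) (use assms in \<open>auto simp: absorb_def rooted_def\<close>)

text \<open>
Weighted Cayley formula: arcs into \<open>y\<close> have weight \<open>b y\<close>. Expanding along one row stays inside this family
of matrices, since merging two vertices adds their values of \<open>b\<close>.
\<close>

lemma forest_sum_complete:
  assumes "finite U" "U \<noteq> {}"
  shows "forest_sum U (rooted z (\<lambda>x y. b y)) = z * (z + sum b U) ^ (card U - 1)"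
  using assms
proof (induction "card U" arbitrary: U z b)
  case 0 then show ?case by simp
next
  case (Suc k)
  from Suc.prems obtain u where u: "u \<in> U" by blast
  let ?V = "U - {u}"
  have cV: "k = card ?V" using Suc.hyps(2) Suc.prems u by simp
  have sumU: "sum b U = b u + sum b ?V" using Suc.prems u by (simp add: sum.remove)
  show ?case
  proof (cases "?V = {}")
    case True
    then have "U = {u}" using u by auto
    then show ?thesis
      using forest_sum_expand[of U u "rooted z (\<lambda>x y. b y)"] by (simp add: rooted_def)
  next
    case False
    have fV: "finite ?V" using Suc.prems by simp
    have kpos: "k = Suc (k - 1)" using cV False fV by (cases k) auto
    have root: "forest_sum ?V (absorb u u (rooted z (\<lambda>x y. b y))) = (z + b u) * (z + sum b U) ^ (k - 1)"
    proof -
      have "forest_sum ?V (absorb u u (rooted z (\<lambda>x y. b y)))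
          = forest_sum ?V (rooted (z + b u) (\<lambda>x y. b y))"
        by (rule forest_sum_cong) (auto simp: absorb_def rooted_def)
      then show ?thesis using Suc.hyps(1)[OF cV fV False, of "z + b u" b] cV sumU
        by (simp add: algebra_simps)
    qed
    have other: "forest_sum ?V (absorb u w (rooted z (\<lambda>x y. b y))) = z * (z + sum b U) ^ (k - 1)"
      if w: "w \<in> ?V" for w
    proof -
      define b1 where "b1 = b(w := b w + b u)"
      have "(\<lambda>x y. b y + (if y = w then b u else 0)) = (\<lambda>x::'a. b1)"
        by (intro ext) (auto simp: b1_def)
      moreover have "sum b1 ?V = sum b U"
        using fV w sumU by (simp add: b1_def sum.remove[of ?V w])
      ultimately show ?thesis
        using Suc.hyps(1)[OF cV fV False, of z b1] forest_sum_absorb_rooted[of w u U z "\<lambda>x y. b y"] w cV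
        by simp
    qed
    have "forest_sum U (rooted z (\<lambda>x y. b y))
        = (\<Sum>w\<in>U. rooted z (\<lambda>x y. b y) u w * forest_sum ?V (absorb u w (rooted z (\<lambda>x y. b y))))"
      by (rule forest_sum_expand[OF Suc.prems(1) u])
    also have "\<dots> = rooted z (\<lambda>x y. b y) u u * forest_sum ?V (absorb u u (rooted z (\<lambda>x y. b y)))
        + (\<Sum>w\<in>?V. rooted z (\<lambda>x y. b y) u w * forest_sum ?V (absorb u w (rooted z (\<lambda>x y. b y))))"
      by (rule sum.remove[OF Suc.prems(1) u])
    also have "\<dots> = z * ((z + b u) * (z + sum b U) ^ (k - 1))
        + (\<Sum>w\<in>?V. b w * (z * (z + sum b U) ^ (k - 1)))"
      unfolding root by (intro arg_cong2[where f = "(+)"] sum.cong) (auto simp: other rooted_def)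
    also have "\<dots> = z * (z + sum b U) ^ k"
      unfolding sum_distrib_right[symmetric] by (subst (3) kpos) (simp add: sumU algebra_simps)
    finally show ?thesis using cV Suc.hyps(2)[symmetric] by simp
  qed
qed

text \<open>
Both sides are affine in every entry \<open>a u w\<close>, and the coefficient of that entry is the same expression for
the graph in which \<open>u\<close> is merged into \<open>w\<close>, where \<open>sum b U\<close> is unchanged. So the arcs of \<open>a\<close> can be removed
one by one, and the weighted Cayley formula remains. For determinants this is the rank-one update of
\<open>z I + L + (sum b U) I\<close> by the matrix all of whose rows equal \<open>b\<close>. Negative weights are allowed, which
the application to joins relies on.
\<close>

lemma forest_sum_shift:
  assumes "finite U"
  shows "(z + sum b U) * forest_sum U (rooted z (\<lambda>x y. a x y + b y)) =
         z * forest_sum U (rooted (z + sum b U) a)"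
  using assms
proof (induction "card U" arbitrary: U a b rule: less_induct)
  case less
  note IHvert = less.hyps
  define supp where "supp a = {(x, y). x \<in> U \<and> y \<in> U \<and> x \<noteq> y \<and> a x y \<noteq> (0::real)}" for a
  have finS: "finite (supp a)" for a
    by (rule finite_subset[of _ "U \<times> U"]) (auto simp: supp_def less.prems)
  show ?case
  proof (induction "card (supp a)" arbitrary: a rule: less_induct)
    case (less a)
    note IHarc = less.hyps
    show ?case
    proof (cases "supp a = {}")
      case True
      then have zero: "a x y = 0" if "x \<in> U" "y \<in> U" "x \<noteq> y" for x y
        using that by (auto simp: supp_def)
      have 1: "forest_sum U (rooted z (\<lambda>x y. a x y + b y)) = forest_sum U (rooted z (\<lambda>x y. b y))"
        and 2: "forest_sum U (rooted (z + sum b U) a) = forest_sum U (rooted (z + sum b U) (\<lambda>x y. 0))"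
        by (rule forest_sum_cong; auto simp: rooted_def zero)+
      show ?thesis
      proof (cases "U = {}")
        case False
        then have "card U = Suc (card U - 1)" using \<open>finite U\<close> by (cases "card U") auto
        then show ?thesis unfolding 1 2
          using forest_sum_complete[OF \<open>finite U\<close> False, of z b]
            forest_sum_complete[OF \<open>finite U\<close> False, of "z + sum b U" "\<lambda>_. 0"]
          by simp
      qed simp
    next
      case False
      then obtain u w where uw: "u \<in> U" "w \<in> U" "u \<noteq> w" "a u w \<noteq> 0" by (auto simp: supp_def)
      let ?V = "U - {u}"
      define a0 where "a0 = (\<lambda>x y. if (x, y) = (u, w) then 0 else a x y)"
      define a1 where "a1 = (\<lambda>x y. a0 x y + (if y = w then a0 x u else 0))"
      define b1 where "b1 = b(w := b w + b u)"
      have "supp a0 = supp a - {(u, w)}" by (auto simp: supp_def a0_def)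
      moreover have "(u, w) \<in> supp a" using uw by (simp add: supp_def)
      ultimately have "card (supp a0) < card (supp a)"
        using finS[of a] by (metis card_Diff1_less)
      then have arc: "(z + sum b U) * forest_sum U (rooted z (\<lambda>x y. a0 x y + b y)) =
          z * forest_sum U (rooted (z + sum b U) a0)" by (rule IHarc)
      have sb: "sum b1 ?V = sum b U"
        using \<open>finite U\<close> uw by (simp add: b1_def sum.remove[of U u] sum.remove[of ?V w])
      have "card ?V < card U" using \<open>finite U\<close> uw by (intro psubset_card_mono) auto
      then have V: "(z + sum b1 ?V) * forest_sum ?V (rooted z (\<lambda>x y. a1 x y + b1 y)) =
          z * forest_sum ?V (rooted (z + sum b1 ?V) a1)" by (rule IHvert) (use \<open>finite U\<close> in simp)
      have "(\<lambda>x y. a0 x y + b y + (if y = w then a0 x u + b u else 0)) = (\<lambda>x y. a1 x y + b1 y)"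
        by (intro ext) (simp add: a1_def b1_def)
      then have L: "forest_sum ?V (absorb u w (rooted z (\<lambda>x y. a0 x y + b y)))
          = forest_sum ?V (rooted z (\<lambda>x y. a1 x y + b1 y))"
        using uw forest_sum_absorb_rooted[of w u U z "\<lambda>x y. a0 x y + b y"] by simp
      have R: "forest_sum ?V (absorb u w (rooted (z + sum b U) a0))
          = forest_sum ?V (rooted (z + sum b U) a1)"
        using uw forest_sum_absorb_rooted[of w u U "z + sum b U" a0] by (simp add: a1_def)
      have "forest_sum U (rooted z (\<lambda>x y. a x y + b y)) = forest_sum U (rooted z (\<lambda>x y. a0 x y + b y))
          + a u w * forest_sum ?V (rooted z (\<lambda>x y. a1 x y + b1 y))"
        using uw forest_sum_change_entry[OF \<open>finite U\<close> uw(1,2),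
            of "rooted z (\<lambda>x y. a x y + b y)" "rooted z (\<lambda>x y. a0 x y + b y)"]
        unfolding L by (auto simp: rooted_def a0_def)
      moreover have "forest_sum U (rooted (z + sum b U) a) = forest_sum U (rooted (z + sum b U) a0)
          + a u w * forest_sum ?V (rooted (z + sum b U) a1)"
        using uw forest_sum_change_entry[OF \<open>finite U\<close> uw(1,2),
            of "rooted (z + sum b U) a" "rooted (z + sum b U) a0"]
        unfolding R by (auto simp: rooted_def a0_def)
      ultimately show ?thesis using arc V unfolding sb by (simp add: algebra_simps)
    qed
  qed
qed

lemma forest_sum_union:
  assumes "finite X" "finite Y" "X \<inter> Y = {}"
    and "\<And>x y. x \<in> X \<Longrightarrow> y \<in> Y \<Longrightarrow> m x y = 0" "\<And>x y. x \<in> Y \<Longrightarrow> y \<in> X \<Longrightarrow> m x y = 0"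
  shows "forest_sum (X \<union> Y) m = forest_sum X m * forest_sum Y m"
  using assms
proof (induction "card X" arbitrary: X m)
  case 0 then show ?case by simp
next
  case (Suc k)
  then obtain u where u: "u \<in> X" by fastforce
  have XY: "(X \<union> Y) - {u} = (X - {u}) \<union> Y" using u Suc.prems by auto
  have step: "forest_sum ((X - {u}) \<union> Y) (absorb u w m)
      = forest_sum (X - {u}) (absorb u w m) * forest_sum Y m" if "w \<in> X" for w
  proof -
    have "forest_sum ((X - {u}) \<union> Y) (absorb u w m)
      = forest_sum (X - {u}) (absorb u w m) * forest_sum Y (absorb u w m)"
    proof (rule Suc.hyps(1))
      show "k = card (X - {u})" using Suc.hyps(2) Suc.prems u by simp
    qed (use Suc.prems u that in \<open>auto simp: absorb_def\<close>)
    moreover have "forest_sum Y (absorb u w m) = forest_sum Y m"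
      by (rule forest_sum_cong) (use Suc.prems u in \<open>auto simp: absorb_def\<close>)
    ultimately show ?thesis by simp
  qed
  have "forest_sum (X \<union> Y) m
      = (\<Sum>w\<in>X \<union> Y. m u w * forest_sum ((X - {u}) \<union> Y) (absorb u w m))"
    using forest_sum_expand[of "X \<union> Y" u m] Suc.prems u unfolding XY by simp
  also have "\<dots> = (\<Sum>w\<in>X. m u w * forest_sum ((X - {u}) \<union> Y) (absorb u w m))"
    by (rule sum.mono_neutral_right) (use Suc.prems u in auto)
  also have "\<dots> = (\<Sum>w\<in>X. m u w * forest_sum (X - {u}) (absorb u w m)) * forest_sum Y m"
    unfolding sum_distrib_right by (intro sum.cong refl) (simp add: step)
  also have "\<dots> = forest_sum X m * forest_sum Y m"
    using forest_sum_expand[of X u m] Suc.prems u by simp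
  finally show ?case .
qed

text \<open>
A forest on \<open>U\<close> has at most \<open>card U\<close> roots.
\<close>

lemma forest_sum_rooted_scale:
  assumes "finite U" "0 < z'" "z' \<le> z" "\<And>x y. x \<in> U \<Longrightarrow> y \<in> U \<Longrightarrow> 0 \<le> a x y"
  shows "forest_sum U (rooted z a) \<le> (z / z') ^ card U * forest_sum U (rooted z' a)"
proof -
  have "(\<Prod>x\<in>U. rooted z a x (f x)) \<le> (z / z') ^ card U * (\<Prod>x\<in>U. rooted z' a x (f x))"
    if f: "f \<in> forests U" for f
  proof -
    have "(\<Prod>x\<in>U. rooted z a x (f x)) \<le> (\<Prod>x\<in>U. (z / z') * rooted z' a x (f x))"
    proof (rule prod_mono)
      fix x assume x: "x \<in> U"
      then have "0 \<le> a x (f x)" using f assms(4) by (auto simp: forests_def)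
      moreover have "1 \<le> z / z'" using assms by simp
      ultimately have "a x (f x) \<le> (z / z') * a x (f x)" by (metis mult_1 mult_right_mono)
      then show "0 \<le> rooted z a x (f x) \<and> rooted z a x (f x) \<le> z / z' * rooted z' a x (f x)"
        using assms \<open>0 \<le> a x (f x)\<close> by (simp add: rooted_def)
    qed
    then show ?thesis by (simp only: prod.distrib prod_constant)
  qed
  then show ?thesis unfolding forest_sum_def sum_distrib_left by (intro sum_mono)
qed

text \<open>
Subtracting 1 from every arc weight removes all arcs between the parts at the price of the root weight
\<open>z + n\<close>; the sum then factors, and adding 1 back inside a part \<open>X\<close> lowers the root weight there to
\<open>z + n - card X\<close>.
\<close>

lemma forest_sum_join3:
  fixes a :: "'a \<Rightarrow> 'a \<Rightarrow> real"
  assumes fin: "finite A" "finite B" "finite C"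
    and disj: "A \<inter> B = {}" "A \<inter> C = {}" "B \<inter> C = {}"
    and cross: "\<And>x y. (x, y) \<in> A \<times> B \<union> A \<times> C \<union> B \<times> C \<Longrightarrow> a x y = 1 \<and> a y x = 1"
    and ne: "A \<noteq> {}" "B \<noteq> {}" "C \<noteq> {}" and z: "0 < z"
    and n: "n = real (card (A \<union> B \<union> C))"
  shows "forest_sum (A \<union> B \<union> C) (rooted z a) =
     z * (z + n)\<^sup>2
       * (forest_sum A (rooted (z + n - card A) a) / (z + n - card A))
       * (forest_sum B (rooted (z + n - card B) a) / (z + n - card B))
       * (forest_sum C (rooted (z + n - card C) a) / (z + n - card C))"
proof -
  let ?V = "A \<union> B \<union> C"
  let ?a = "\<lambda>x y. a x y - 1"
  have cardV: "n = card A + card B + card C"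
    unfolding n using fin disj by (simp add: card_Un_disjoint Int_Un_distrib2)
  have pos: "0 < card A" "0 < card B" "0 < card C" using fin ne by (simp_all add: card_gt_0_iff)
  have block: "forest_sum X (rooted (z + n) ?a)
      = (z + n) * (forest_sum X (rooted (z + n - card X) a) / (z + n - card X))"
    if X: "finite X" and nz: "0 < z + n - card X" for X
    using forest_sum_shift[OF X, of "z + n" "\<lambda>_. -1" a] nz by (simp add: field_simps)
  have posA: "0 < z + n - card A" and posB: "0 < z + n - card B" and posC: "0 < z + n - card C"
    using z cardV by simp_all
  have zeros: "rooted (z + n) ?a x y = 0" "rooted (z + n) ?a y x = 0"
    if "(x, y) \<in> A \<times> B \<union> A \<times> C \<union> B \<times> C" for x y
    using cross[OF that] that disj by (auto simp: rooted_def)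
  have "forest_sum ?V (rooted (z + n) ?a)
      = forest_sum (A \<union> B) (rooted (z + n) ?a) * forest_sum C (rooted (z + n) ?a)"
    by (rule forest_sum_union) (use fin disj zeros in auto)
  also have "forest_sum (A \<union> B) (rooted (z + n) ?a)
      = forest_sum A (rooted (z + n) ?a) * forest_sum B (rooted (z + n) ?a)"
    by (rule forest_sum_union) (use fin disj zeros in auto)
  finally have prod: "forest_sum ?V (rooted (z + n) ?a) = forest_sum A (rooted (z + n) ?a)
      * forest_sum B (rooted (z + n) ?a) * forest_sum C (rooted (z + n) ?a)" .
  have "(z + n) * forest_sum ?V (rooted z a) = z * forest_sum ?V (rooted (z + n) ?a)"
    using forest_sum_shift[of ?V z "\<lambda>_. 1" ?a] fin n by simp
  then have "(z + n) * forest_sum ?V (rooted z a) = z *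
      (((z + n) * (forest_sum A (rooted (z + n - card A) a) / (z + n - card A)))
      * ((z + n) * (forest_sum B (rooted (z + n - card B) a) / (z + n - card B)))
      * ((z + n) * (forest_sum C (rooted (z + n - card C) a) / (z + n - card C))))"
    unfolding prod block[OF fin(1) posA] block[OF fin(2) posB] block[OF fin(3) posC] .
  also have "\<dots> = (z + n) * (z * (z + n)\<^sup>2
       * (forest_sum A (rooted (z + n - card A) a) / (z + n - card A))
       * (forest_sum B (rooted (z + n - card B) a) / (z + n - card B))
       * (forest_sum C (rooted (z + n - card C) a) / (z + n - card C)))"
    by (simp only: power2_eq_square ac_simps)
  finally show ?thesis using z cardV by (subst (asm) mult_cancel_left) simp
qed

section \<open>Forests after deletion of a vertex\<close>

text \<open>
Among the forests with root \<open>x\<close>, those in which \<open>x'\<close> does not lie below \<open>x\<close> correspond to the forests in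
which \<open>x\<close> is a child of \<open>x'\<close>. They make up at least the fraction \<open>s / (s + 1)\<close>: if \<open>x'\<close> lies below \<open>x\<close>,
cut the last arc of the path from \<open>x'\<close> to \<open>x\<close>. Its tail becomes the root of the tree of
\<open>x'\<close>, so the cut can be undone, and by \<open>dom\<close> the weight grows by a factor at least \<open>s\<close>.
\<close>

lemma cofactor_root_le_arc:
  fixes U :: "'a set" and m :: "'a \<Rightarrow> 'a \<Rightarrow> real"
  assumes fin: "finite U" and x: "x \<in> U" and x': "x' \<in> U" "x' \<noteq> x" and s: "0 \<le> s"
    and nn: "\<And>y z. y \<in> U \<Longrightarrow> z \<in> U \<Longrightarrow> 0 \<le> m y z"
    and dom: "\<And>y. y \<in> U - {x} \<Longrightarrow> s * m y x \<le> m y y"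
  shows "s * cofactor U m x x \<le> (s + 1) * cofactor U m x x'"
proof -
  let ?W = "\<lambda>f. \<Prod>y\<in>U - {x}. m y (f y)"
  define hit where "hit f y \<longleftrightarrow> (\<exists>n. (f ^^ n) y = x)" for f :: "'a \<Rightarrow> 'a" and y
  define K1 where "K1 = {f \<in> forests U. f x = x \<and> hit f x'}"
  define K0 where "K0 = {f \<in> forests U. f x = x \<and> \<not> hit f x'}"
  have finK: "finite K0" "finite K1" unfolding K0_def K1_def using fin by (simp_all add: finite_forests)
  have Wnn: "0 \<le> ?W f" if "f \<in> forests U" for f
    using that by (intro prod_nonneg) (auto intro!: nn simp: forests_def)
  have split: "cofactor U m x x = sum ?W K1 + sum ?W K0"
    unfolding cofactor_def
    by (subst sum.union_disjoint[symmetric])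
      (auto simp: K0_def K1_def fin finite_forests intro!: sum.cong)
  have arc: "sum ?W K0 \<le> cofactor U m x x'"
  proof -
    let ?r = "\<lambda>f. f(x := x')"
    have inj: "inj_on ?r K0"
    proof (rule inj_onI)
      fix f g assume "f \<in> K0" "g \<in> K0" and e: "f(x := x') = g(x := x')"
      then have "f x = g x" by (simp add: K0_def)
      then show "f = g" using fun_cong[OF e] by (metis fun_upd_other ext)
    qed
    have "sum ?W K0 = sum ?W (?r ` K0)"
      unfolding sum.reindex[OF inj] by (auto intro!: sum.cong prod.cong)
    also have "\<dots> \<le> cofactor U m x x'"
      unfolding cofactor_def
    proof (rule sum_mono2)
      show "finite {f \<in> forests U. f x = x'}" using fin by (simp add: finite_forests)
      show "?r ` K0 \<subseteq> {f \<in> forests U. f x = x'}"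
      proof (safe)
        fix f assume f: "f \<in> K0"
        then have "f \<in> forests U" "f x = x" "\<not> hit f x'" by (auto simp: K0_def)
        then obtain h :: "'a \<Rightarrow> nat" where fU: "f \<in> U \<rightarrow>\<^sub>E U" and
          h: "\<And>y. y \<in> U \<Longrightarrow> f y \<noteq> y \<Longrightarrow> h (f y) < h y" by (auto simp: forests_def)
        have hit_step: "hit f (f y) = hit f y" if "y \<noteq> x" for y
        proof
          assume "hit f (f y)"
          then obtain n where "(f ^^ n) (f y) = x" by (auto simp: hit_def)
          then have "(f ^^ Suc n) y = x" by (simp add: funpow_swap1)
          then show "hit f y" unfolding hit_def by blast
        next
          assume "hit f y"
          then obtain n where n: "(f ^^ n) y = x" by (auto simp: hit_def)
          with that obtain k where "n = Suc k" by (cases n) auto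
          then have "(f ^^ k) (f y) = x" using n by (simp add: funpow_swap1)
          then show "hit f (f y)" unfolding hit_def by blast
        qed
        have "hit f x" unfolding hit_def by (rule exI[of _ 0]) simp
        show "f(x := x') \<in> forests U"
        \<comment> \<open>The whole tree of \<open>x\<close> is lifted above \<open>x'\<close>.\<close>
        proof (rule forestsI[where h = "\<lambda>y. if hit f y then h y + h x' + 1 else h y"])
          show "f(x := x') \<in> U \<rightarrow>\<^sub>E U"
            using fU x x' unfolding PiE_def extensional_def by auto
          fix y assume "y \<in> U" "(f(x := x')) y \<noteq> y"
          then show "(if hit f ((f(x := x')) y) then h ((f(x := x')) y) + h x' + 1
                       else h ((f(x := x')) y)) < (if hit f y then h y + h x' + 1 else h y)"
            using h[of y] \<open>hit f x\<close> \<open>\<not> hit f x'\<close> hit_step[of y] by (cases "y = x") auto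
        qed
      qed simp
    qed (auto intro!: prod_nonneg nn simp: forests_def)
    finally show ?thesis .
  qed
  have cut: "s * sum ?W K1 \<le> sum ?W K0"
  proof -
    \<comment> \<open>\<open>lst f\<close> is the child of \<open>x\<close> on the path from \<open>x'\<close> to \<open>x\<close>.\<close>
    define len where "len f = (LEAST n. (f ^^ n) x' = x)" for f
    define lst where "lst f = (f ^^ (len f - 1)) x'" for f
    define \<phi> where "\<phi> f = f(lst f := lst f)" for f
    have props: "\<phi> f \<in> K0 \<and> f (lst f) = x \<and> lst f \<in> U - {x}
         \<and> (\<forall>i \<ge> len f - 1. ((\<phi> f) ^^ i) x' = lst f)" if f: "f \<in> K1" for f
    proof -
      have fF: "f \<in> forests U" and fx: "f x = x" and "hit f x'" using f by (auto simp: K1_def)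
      have len: "(f ^^ len f) x' = x"
        using \<open>hit f x'\<close> unfolding len_def hit_def by (rule LeastI_ex)
      have before: "(f ^^ i) x' \<noteq> x" if "i < len f" for i
        using that unfolding len_def by (rule not_less_Least)
      obtain k where k: "len f = Suc k"
      proof (cases "len f")
        case 0 then show ?thesis using len x' by simp
      qed
      then have len': "len f = Suc (len f - 1)" by simp
      have flst: "f (lst f) = x" using len unfolding lst_def k by simp
      have inU: "(f ^^ i) x' \<in> U" for i
        using fF x' by (induction i) (auto simp: forests_def)
      have nx: "lst f \<noteq> x" unfolding lst_def by (rule before) (use len' in simp)
      have same: "((\<phi> f) ^^ i) x' = (f ^^ i) x'" if "i \<le> len f - 1" for i
        using that
      proof (induction i)
        case (Suc i)
        have "(f ^^ Suc i) x' \<noteq> x" by (rule before) (use Suc.prems len' in simp)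
        then have "(f ^^ i) x' \<noteq> lst f" using flst by auto
        then show ?case using Suc by (simp add: \<phi>_def)
      qed simp
      have later: "((\<phi> f) ^^ (len f - 1 + i)) x' = lst f" for i
      proof (induction i)
        case 0 show ?case using same[of "len f - 1"] by (simp add: lst_def)
      next
        case (Suc i) then show ?case by (simp add: \<phi>_def)
      qed
      have later': "((\<phi> f) ^^ i) x' = lst f" if "i \<ge> len f - 1" for i
        using later[of "i - (len f - 1)"] that by simp
      have "\<not> hit (\<phi> f) x'"
      proof
        assume "hit (\<phi> f) x'"
        then obtain i where i: "((\<phi> f) ^^ i) x' = x" by (auto simp: hit_def)
        show False
        proof (cases "i \<le> len f - 1")
          case True
          then show False using i same[OF True] before[of i] len' by simp
        next
          case False
          then show False using i later'[of i] nx by simp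
        qed
      qed
      moreover have "\<phi> f \<in> forests U"
      proof -
        from fF obtain h :: "'a \<Rightarrow> nat" where fU: "f \<in> U \<rightarrow>\<^sub>E U" and
          h: "\<And>y. y \<in> U \<Longrightarrow> f y \<noteq> y \<Longrightarrow> h (f y) < h y" by (rule forestsE) blast
        have "lst f \<in> U" unfolding lst_def by (rule inU)
        then show ?thesis using fU h unfolding \<phi>_def
          by (intro forestsI[where h = h]) (auto simp: PiE_def extensional_def)
      qed
      moreover have "\<phi> f x = x" using fx nx by (simp add: \<phi>_def)
      ultimately show ?thesis using flst nx later' inU by (auto simp: K0_def lst_def)
    qed
    have inj: "inj_on \<phi> K1"
    proof (rule inj_onI)
      fix f g assume f: "f \<in> K1" and g: "g \<in> K1" and e: "\<phi> f = \<phi> g"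
      define i where "i = max (len f - 1) (len g - 1)"
      have "lst f = ((\<phi> f) ^^ i) x'" using props[OF f] by (simp add: i_def)
      also have "\<dots> = lst g" unfolding e using props[OF g] by (simp add: i_def)
      finally have l: "lst f = lst g" .
      show "f = g"
      proof
        fix y show "f y = g y"
        proof (cases "y = lst f")
          case True then show ?thesis using props[OF f] props[OF g] l by simp
        next
          case False
          then show ?thesis using fun_cong[OF e, of y] l by (simp add: \<phi>_def)
        qed
      qed
    qed
    have "s * ?W f \<le> ?W (\<phi> f)" if f: "f \<in> K1" for f
    proof -
      let ?w = "lst f"
      have w: "?w \<in> U - {x}" and fw: "f ?w = x" using props[OF f] by auto
      have P: "0 \<le> (\<Prod>y\<in>U - {x} - {?w}. m y (f y))"
        using f by (intro prod_nonneg) (auto intro!: nn simp: K1_def forests_def)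
      have "?W f = m ?w x * (\<Prod>y\<in>U - {x} - {?w}. m y (f y))"
        using fin w fw by (subst prod.remove[of _ ?w]) auto
      moreover have "?W (\<phi> f) = m ?w ?w * (\<Prod>y\<in>U - {x} - {?w}. m y (f y))"
        using fin w by (subst prod.remove[of _ ?w]) (auto simp: \<phi>_def intro!: prod.cong)
      ultimately show ?thesis
        using mult_right_mono[OF dom[OF w] P] by (simp add: mult.assoc)
    qed
    then have "s * sum ?W K1 \<le> (\<Sum>f\<in>K1. ?W (\<phi> f))"
      unfolding sum_distrib_left by (rule sum_mono)
    also have "\<dots> = sum ?W (\<phi> ` K1)" by (simp add: sum.reindex[OF inj])
    also have "\<dots> \<le> sum ?W K0"
      by (rule sum_mono2) (use finK props Wnn in \<open>auto simp: K0_def\<close>)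
    finally show ?thesis .
  qed
  have "s * cofactor U m x x \<le> (s + 1) * sum ?W K0"
    using cut unfolding split by (simp add: algebra_simps)
  also have "\<dots> \<le> (s + 1) * cofactor U m x x'" using arc s by (intro mult_left_mono) auto
  finally show ?thesis .
qed

definition adj :: "('a \<times> 'a) set \<Rightarrow> 'a \<Rightarrow> 'a \<Rightarrow> real" where
  "adj E x y = of_bool ((x, y) \<in> E)"

lemma rooted_adj_nonneg: "0 \<le> s \<Longrightarrow> 0 \<le> rooted s (adj E) x y"
  by (simp add: rooted_def adj_def)

lemma forest_sum_root_rows_insert:
  assumes "finite U" "x \<in> U"
  shows "forest_sum U (root_rows (insert x S) m) = cofactor U (root_rows S m) x x"
proof -
  have "forest_sum U (root_rows (insert x S) m) = cofactor U (root_rows (insert x S) m) x x"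
    by (rule forest_sum_unit_row) (use assms in \<open>auto simp: root_rows_def\<close>)
  also have "\<dots> = cofactor U (root_rows S m) x x"
    by (rule cofactor_cong) (simp add: root_rows_def)
  finally show ?thesis .
qed

text \<open>
The vertex \<open>x\<close> is a root with weight \<open>s\<close>, or a child of any of its neighbours; by the previous estimate every
neighbour contributes at least \<open>s / (s + 1)\<close> times the forests with root \<open>x\<close>. In electrical terms this bounds the
resistance between \<open>x\<close> and the ground.
\<close>

lemma forest_sum_root_rows_le:
  assumes fin: "finite U" and x: "x \<in> U - S" and s: "0 < s"
    and K: "K \<subseteq> U - {x}" "\<And>y. y \<in> K \<Longrightarrow> (x, y) \<in> E"
  shows "(s + card K * (s / (s + 1))) * forest_sum U (root_rows (insert x S) (rooted s (adj E)))
         \<le> forest_sum U (root_rows S (rooted s (adj E)))"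
proof -
  let ?M = "root_rows S (rooted s (adj E))"
  let ?c = "cofactor U ?M x"
  have xU: "x \<in> U" and xS: "x \<notin> S" using x by auto
  have nn: "0 \<le> ?M y z" for y z
    using s by (simp add: root_rows_def rooted_adj_nonneg)
  have cnn: "0 \<le> ?c w" for w by (rule cofactor_nonneg) (rule nn)
  have arc: "s / (s + 1) * ?c x \<le> ?c w" if "w \<in> K" for w
  proof -
    have "s * ?c x \<le> (s + 1) * ?c w"
      by (rule cofactor_root_le_arc[OF fin xU _ _ _ nn])
        (use s that K in \<open>auto simp: root_rows_def rooted_def adj_def\<close>)
    then show ?thesis using s by (simp add: field_simps)
  qed
  have finK: "finite K" using fin K(1) by (meson finite_Diff finite_subset)
  have "(s + card K * (s / (s + 1))) * ?c x = s * ?c x + (\<Sum>w\<in>K. s / (s + 1) * ?c x)"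
    by (simp add: algebra_simps)
  also have "\<dots> \<le> s * ?c x + (\<Sum>w\<in>K. ?c w)" by (intro add_left_mono sum_mono arc)
  also have "\<dots> = (\<Sum>w\<in>insert x K. ?M x w * ?c w)"
    using finK K xS by (subst sum.insert) (auto simp: root_rows_def rooted_def adj_def intro!: sum.cong)
  also have "\<dots> \<le> (\<Sum>w\<in>U. ?M x w * ?c w)"
    using fin K xU nn cnn by (intro sum_mono2) auto
  also have "\<dots> = forest_sum U ?M" by (rule forest_sum_cofactor[symmetric, OF fin xU])
  finally show ?thesis using forest_sum_root_rows_insert[OF fin xU, of S "rooted s (adj E)"] by simp
qed

text \<open>
Expansion along row \<open>v\<close>: if \<open>v\<close> is a root, its neighbours get one more unit of root weight, and if \<open>v\<close> is a
child of its neighbour \<open>w\<close>, each other neighbour gets one more arc to \<open>w\<close>.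
\<close>

lemma forest_sum_add_vertex:
  fixes s r :: real
  assumes fin: "finite A" and v: "v \<in> A" and sym: "sym E" and s: "0 < s" and r: "0 \<le> r"
    and N: "N = {u \<in> A - {v}. (v, u) \<in> E}"
    and root: "\<And>S x. S \<subseteq> N \<Longrightarrow> x \<in> N - S \<Longrightarrow>
       forest_sum (A - {v}) (root_rows (insert x S) (rooted s (adj E)))
         \<le> r * forest_sum (A - {v}) (root_rows S (rooted s (adj E)))"
  shows "forest_sum A (rooted s (adj E)) \<le>
     (s * (1 + r) ^ card N + card N * (1 + r) ^ (card N - 1))
       * forest_sum (A - {v}) (rooted s (adj E))"
proof -
  let ?U = "A - {v}" and ?m = "rooted s (adj E)"
  let ?F = "forest_sum (A - {v}) (rooted s (adj E))"
  have NU: "N \<subseteq> ?U" and finN: "finite N" using N fin by auto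
  have adjN: "(x, v) \<in> E \<longleftrightarrow> x \<in> N" "(v, x) \<in> E \<longleftrightarrow> x \<in> N" if "x \<in> ?U" for x
    using that sym N by (auto simp: sym_def)
  have nn: "0 \<le> ?m y z" for y z using s by (simp add: rooted_adj_nonneg)
  have loop: "forest_sum ?U (absorb v v ?m) \<le> (1 + r) ^ card N * ?F"
  proof -
    have "forest_sum ?U (absorb v v ?m) = forest_sum ?U (bump N (\<lambda>x. x) ?m)"
      by (rule forest_sum_cong) (use adjN in \<open>auto simp: absorb_def bump_def rooted_def adj_def\<close>)
    also have "\<dots> \<le> (1 + r) ^ card N * ?F"
      by (rule forest_sum_bump_le) (use fin NU r nn root in auto)
    finally show ?thesis .
  qed
  have arc: "forest_sum ?U (absorb v w ?m) \<le> (1 + r) ^ (card N - 1) * ?F" if w: "w \<in> N" for w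
  proof -
    have "forest_sum ?U (absorb v w ?m) = forest_sum ?U (bump (N - {w}) (\<lambda>_. w) ?m)"
      by (rule forest_sum_cong) (use adjN w NU in \<open>auto simp: absorb_def bump_def rooted_def adj_def\<close>)
    also have "\<dots> \<le> (1 + r) ^ card (N - {w}) * ?F"
    proof (rule forest_sum_bump_le)
      fix S x assume "S \<subseteq> N - {w}" "x \<in> N - {w} - S"
      then show "forest_sum ?U (root_rows (insert x S) ?m) \<le> r * forest_sum ?U (root_rows S ?m)"
        by (intro root) auto
    qed (use fin NU r nn w in auto)
    finally show ?thesis using finN w by simp
  qed
  have Fnn: "0 \<le> forest_sum ?U (absorb v w ?m)" for w
    by (rule forest_sum_nonneg) (use nn in \<open>simp add: absorb_def\<close>)
  have "forest_sum A ?m = (\<Sum>w\<in>A. ?m v w * forest_sum ?U (absorb v w ?m))"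
    by (rule forest_sum_expand[OF fin v])
  also have "\<dots> = s * forest_sum ?U (absorb v v ?m)
        + (\<Sum>w\<in>?U. ?m v w * forest_sum ?U (absorb v w ?m))"
    unfolding sum.remove[OF fin v] by (simp add: rooted_def)
  also have "(\<Sum>w\<in>?U. ?m v w * forest_sum ?U (absorb v w ?m))
      = (\<Sum>w\<in>N. ?m v w * forest_sum ?U (absorb v w ?m))"
    by (rule sum.mono_neutral_right) (use fin NU adjN in \<open>auto simp: rooted_def adj_def\<close>)
  also have "\<dots> = (\<Sum>w\<in>N. forest_sum ?U (absorb v w ?m))"
    by (intro sum.cong refl) (use NU adjN in \<open>auto simp: rooted_def adj_def\<close>)
  also have "s * forest_sum ?U (absorb v v ?m) + (\<Sum>w\<in>N. forest_sum ?U (absorb v w ?m))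
      \<le> s * ((1 + r) ^ card N * ?F) + (\<Sum>w\<in>N. (1 + r) ^ (card N - 1) * ?F)"
    using s by (intro add_mono mult_left_mono sum_mono loop arc) auto
  also have "\<dots> = (s * (1 + r) ^ card N + card N * (1 + r) ^ (card N - 1)) * ?F"
    by (simp add: algebra_simps)
  finally show ?thesis .
qed

section \<open>Acyclic and strong orientations after deletion of a vertex\<close>

text \<open>
Arc sets are used instead of digraphs: \<open>E\<close> is a symmetric relation, and the graph under consideration is its
restriction to a vertex set \<open>U\<close>, so that deleting a vertex only changes \<open>U\<close>.
\<close>

definition orients :: "'a rel \<Rightarrow> 'a rel \<Rightarrow> bool" where
  "orients D E \<longleftrightarrow> D \<union> D\<inverse> = E \<and> D \<inter> D\<inverse> = {}"

text \<open>
These are the acyclic orientations; carrying a topological numbering \<open>h\<close> along makes it possible to insert a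
new vertex at a prescribed place.
\<close>

definition ranked :: "'a set \<Rightarrow> 'a rel \<Rightarrow> 'a rel set" where
  "ranked U E = {D. orients D (Restr E U) \<and>
     (\<exists>h::'a \<Rightarrow> nat. inj_on h U \<and> (\<forall>(x, y)\<in>D. h x < h y))}"

text \<open>
For a connected graph these are the totally cyclic orientations.
\<close>

definition strong :: "'a set \<Rightarrow> 'a rel \<Rightarrow> 'a rel set" where
  "strong U E = {D. orients D (Restr E U) \<and> (\<forall>x\<in>U. \<forall>y\<in>U. (x, y) \<in> D\<^sup>*)}"

lemma orients_subset: "orients D E \<Longrightarrow> D \<subseteq> E"
  by (auto simp: orients_def)

lemma finite_orients: "finite E \<Longrightarrow> finite {D. orients D E}"
  by (rule finite_subset[of _ "Pow E"]) (auto dest: orients_subset)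

lemma finite_ranked: "finite U \<Longrightarrow> finite (ranked U E)"
  and finite_strong: "finite U \<Longrightarrow> finite (strong U E)"
  by (rule finite_subset[OF _ finite_orients[of "Restr E U"]]; auto simp: ranked_def strong_def)+

text \<open>
Orient all edges between \<open>v\<close> and its neighbourhood \<open>N\<close>: those at \<open>S\<close> towards \<open>v\<close>, the others away from \<open>v\<close>.
\<close>

definition attach :: "'a \<Rightarrow> 'a set \<Rightarrow> 'a rel \<Rightarrow> 'a set \<Rightarrow> 'a rel" where
  "attach v N D S = D \<union> S \<times> {v} \<union> {v} \<times> (N - S)"

lemma orients_attach:
  assumes D: "orients D (Restr E (U - {v}))" and v: "v \<in> U" and "sym E" "irrefl E"
    and N: "N = {u \<in> U - {v}. (v, u) \<in> E}" and S: "S \<subseteq> N"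
  shows "orients (attach v N D S) (Restr E U)"
proof -
  have DE: "D \<subseteq> Restr E (U - {v})" by (rule orients_subset[OF D])
  have eq: "Restr E U = Restr E (U - {v}) \<union> N \<times> {v} \<union> {v} \<times> N"
    using v \<open>sym E\<close> \<open>irrefl E\<close> unfolding N by (auto simp: sym_def irrefl_def)
  have vN: "v \<notin> N" using N by simp
  have "attach v N D S \<union> (attach v N D S)\<inverse> = (D \<union> D\<inverse>) \<union> N \<times> {v} \<union> {v} \<times> N"
    using S by (auto simp: attach_def)
  moreover have "attach v N D S \<inter> (attach v N D S)\<inverse> = D \<inter> D\<inverse>"
    using S vN DE by (auto simp: attach_def)
  ultimately show ?thesis using D unfolding orients_def eq by simp
qed

lemma card_attach_le:
  assumes fin: "finite U" and v: "v \<notin> N" and N: "N \<subseteq> U"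
    and F: "finite F" "\<And>D. D \<in> F \<Longrightarrow> D \<subseteq> (U - {v}) \<times> (U - {v})" and H: "finite H"
    and k: "\<And>D. D \<in> F \<Longrightarrow> k \<le> card {S. S \<subseteq> N \<and> attach v N D S \<in> H}"
  shows "k * card F \<le> card H"
proof -
  let ?S = "\<lambda>D. {S. S \<subseteq> N \<and> attach v N D S \<in> H}"
  let ?f = "\<lambda>(D, S). attach v N D S"
  have finS: "finite (?S D)" for D
    using finite_subset[OF N fin] by (rule_tac finite_subset[of _ "Pow N"]) auto
  have "k * card F \<le> (\<Sum>D\<in>F. card (?S D))"
    using sum_bounded_below[of F k "\<lambda>D. card (?S D)"] k by (simp add: mult.commute)
  also have "\<dots> = card (Sigma F ?S)" using F finS by simp
  also have "\<dots> = card (?f ` Sigma F ?S)"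
  proof (rule card_image[symmetric], rule inj_onI, safe)
    fix D S D' S' x y
    assume D: "D \<in> F" "D' \<in> F" and S: "S \<subseteq> N" "S' \<subseteq> N"
      and e: "attach v N D S = attach v N D' S'"
    have D0: "D \<subseteq> (U - {v}) \<times> (U - {v})" "D' \<subseteq> (U - {v}) \<times> (U - {v})" using D F by auto
    have 1: "D = attach v N D S \<inter> (U - {v}) \<times> (U - {v})" "S = {u. (u, v) \<in> attach v N D S}"
      using D0 S v by (auto simp: attach_def)
    have 2: "D' = attach v N D' S' \<inter> (U - {v}) \<times> (U - {v})" "S' = {u. (u, v) \<in> attach v N D' S'}"
      using D0 S v by (auto simp: attach_def)
    have "D = D'" "S = S'" using 1 2 e by metis+
    then show "(x, y) \<in> D \<Longrightarrow> (x, y) \<in> D'" "(x, y) \<in> D' \<Longrightarrow> (x, y) \<in> D"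
      "z \<in> S \<Longrightarrow> z \<in> S'" "z \<in> S' \<Longrightarrow> z \<in> S" for z by auto
  qed
  also have "\<dots> \<le> card H" by (rule card_mono[OF H]) auto
  finally show ?thesis .
qed

text \<open>
The thresholds are the values of \<open>h\<close> on \<open>N\<close> and one number above all of them.
\<close>

lemma card_initial_segments:
  fixes h :: "'a \<Rightarrow> nat"
  assumes fin: "finite N" and inj: "inj_on h N"
  shows "Suc (card N) \<le> card ((\<lambda>c. {u \<in> N. h u < c}) ` UNIV)" (is "_ \<le> card ?I")
proof -
  let ?s = "\<lambda>c. {u \<in> N. h u < c}"
  let ?C = "insert (Suc (Max (insert 0 (h ` N)))) (h ` N)"
  have bound: "h u < Suc (Max (insert 0 (h ` N)))" if "u \<in> N" for u
    using fin that by (simp add: le_imp_less_Suc)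
  have strict: "?s c \<noteq> ?s d" if cd: "c \<in> ?C" "d \<in> ?C" "c < d" for c d
  proof -
    have "c \<noteq> Suc (Max (insert 0 (h ` N)))"
    proof
      assume "c = Suc (Max (insert 0 (h ` N)))"
      then show False using cd bound by fastforce
    qed
    then obtain u where "u \<in> N" "c = h u" using cd by auto
    then have "u \<in> ?s d" "u \<notin> ?s c" using cd by auto
    then show ?thesis by blast
  qed
  have "inj_on ?s ?C"
  proof (rule inj_onI, rule ccontr)
    fix c d assume "c \<in> ?C" "d \<in> ?C" "?s c = ?s d" "c \<noteq> d"
    then show False using strict[of c d] strict[of d c] by (metis linorder_neqE_nat)
  qed
  then have "card (?s ` ?C) = card ?C" by (rule card_image)
  moreover have "card ?C = Suc (card N)"
  proof -
    have "Suc (Max (insert 0 (h ` N))) \<notin> h ` N" using bound by fastforce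
    then show ?thesis using fin inj by (simp add: card_image)
  qed
  moreover have "card (?s ` ?C) \<le> card ?I"
  proof (rule card_mono)
    show "finite ?I" by (rule finite_subset[of _ "Pow N"]) (use fin in auto)
  qed auto
  ultimately show ?thesis by simp
qed

text \<open>
The new vertex can be inserted into the order given by \<open>h\<close> after any initial segment of its neighbourhood.
\<close>

lemma card_ranked_delete:
  assumes fin: "finite U" and v: "v \<in> U" and E: "sym E" "irrefl E"
    and N: "N = {u \<in> U - {v}. (v, u) \<in> E}"
  shows "(card N + 1) * card (ranked (U - {v}) E) \<le> card (ranked U E)"
proof (rule card_attach_le[of U v N])
  show "finite U" "v \<notin> N" "N \<subseteq> U" "finite (ranked (U - {v}) E)" "finite (ranked U E)"
    using fin N by (auto simp: finite_ranked)
  fix D assume D: "D \<in> ranked (U - {v}) E"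
  then have o: "orients D (Restr E (U - {v}))" by (simp add: ranked_def)
  show DU: "D \<subseteq> (U - {v}) \<times> (U - {v})" using orients_subset[OF o] by auto
  from D obtain h :: "'a \<Rightarrow> nat" where inj: "inj_on h (U - {v})" and h: "\<And>x y. (x, y) \<in> D \<Longrightarrow> h x < h y"
    by (auto simp: ranked_def)
  have NU: "N \<subseteq> U - {v}" using N by auto
  have "(\<lambda>c. {u \<in> N. h u < c}) ` UNIV \<subseteq> {S. S \<subseteq> N \<and> attach v N D S \<in> ranked U E}"
  proof safe
    fix c
    let ?S = "{u \<in> N. h u < c}"
    \<comment> \<open>Odd values for the old vertices leave the even value \<open>2 * c\<close> free for \<open>v\<close>.\<close>
    let ?h = "\<lambda>x. if x = v then 2 * c else 2 * h x + 1"
    have "orients (attach v N D ?S) (Restr E U)"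
      by (rule orients_attach[OF o v E N]) auto
    moreover have "inj_on ?h U"
    proof (rule inj_onI)
      fix x y assume "x \<in> U" "y \<in> U" "?h x = ?h y"
      moreover have "2 * c \<noteq> 2 * a + 1" "2 * a + 1 \<noteq> 2 * c" for a by presburger+
      ultimately show "x = y" using inj by (auto split: if_splits dest: inj_onD)
    qed
    moreover have "?h x < ?h y" if xy: "(x, y) \<in> attach v N D ?S" for x y
    proof -
      consider "(x, y) \<in> D" | "x \<in> ?S" "y = v" | "x = v" "y \<in> N - ?S"
        using xy by (auto simp: attach_def)
      then show ?thesis
      proof cases
        case 1 then show ?thesis using h[OF 1] DU by auto
      next
        case 2 then show ?thesis using NU by auto
      next
        case 3 then show ?thesis using NU by auto
      qed
    qed
    ultimately show "attach v N D ?S \<in> ranked U E" unfolding ranked_def by blast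
  qed
  then have "card ((\<lambda>c. {u \<in> N. h u < c}) ` UNIV) \<le> card {S. S \<subseteq> N \<and> attach v N D S \<in> ranked U E}"
    by (rule card_mono[rotated]) (rule finite_subset[of _ "Pow N"], use fin N in auto)
  moreover have "Suc (card N) \<le> card ((\<lambda>c. {u \<in> N. h u < c}) ` UNIV)"
    using fin N by (intro card_initial_segments inj_on_subset[OF inj NU]) simp
  ultimately show "card N + 1 \<le> card {S. S \<subseteq> N \<and> attach v N D S \<in> ranked U E}" by simp
qed

text \<open>
Any choice of arcs at \<open>v\<close> other than all incoming or all outgoing keeps the orientation strong.
\<close>

lemma card_strong_delete:
  assumes fin: "finite U" and v: "v \<in> U" and E: "sym E" "irrefl E"
    and N: "N = {u \<in> U - {v}. (v, u) \<in> E}"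
  shows "(2 ^ card N - 2) * card (strong (U - {v}) E) \<le> card (strong U E)"
proof (rule card_attach_le[of U v N])
  show "finite U" "v \<notin> N" "N \<subseteq> U" "finite (strong (U - {v}) E)" "finite (strong U E)"
    using fin N by (auto simp: finite_strong)
  have finN: "finite N" using fin N by simp
  fix D assume D: "D \<in> strong (U - {v}) E"
  then have o: "orients D (Restr E (U - {v}))" by (simp add: strong_def)
  show "D \<subseteq> (U - {v}) \<times> (U - {v})" using orients_subset[OF o] by auto
  have NU: "N \<subseteq> U - {v}" using N by auto
  have "Pow N - {{}, N} \<subseteq> {S. S \<subseteq> N \<and> attach v N D S \<in> strong U E}"
  proof
    fix S assume "S \<in> Pow N - {{}, N}"
    then have S: "S \<subseteq> N" "S \<noteq> {}" "S \<noteq> N" by auto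
    let ?D = "attach v N D S"
    have "orients ?D (Restr E U)" by (rule orients_attach[OF o v E N S(1)])
    moreover have "(x, y) \<in> ?D\<^sup>*" if x: "x \<in> U" and y: "y \<in> U" for x y
    proof -
      have inner: "(a, b) \<in> ?D\<^sup>*" if "a \<in> U - {v}" "b \<in> U - {v}" for a b
      proof -
        have "(a, b) \<in> D\<^sup>*" using D that by (auto simp: strong_def)
        moreover have "D \<subseteq> ?D" by (auto simp: attach_def)
        ultimately show ?thesis by (meson rtrancl_mono subsetD)
      qed
      from S obtain i j where i: "i \<in> S" and j: "j \<in> N - S" by blast
      then have iv: "(i, v) \<in> ?D" and vj: "(v, j) \<in> ?D" by (auto simp: attach_def)
      have to: "(a, v) \<in> ?D\<^sup>*" if "a \<in> U" for a
      proof (cases "a = v")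
        case False
        then have "(a, i) \<in> ?D\<^sup>*" using inner that i S NU by auto
        then show ?thesis using iv by simp
      qed simp
      have from_v: "(v, b) \<in> ?D\<^sup>*" if "b \<in> U" for b
      proof (cases "b = v")
        case False
        then have "(j, b) \<in> ?D\<^sup>*" using inner that j NU by auto
        then show ?thesis using vj by (meson converse_rtrancl_into_rtrancl)
      qed simp
      show ?thesis using to[OF x] from_v[OF y] by simp
    qed
    ultimately show "S \<in> {S. S \<subseteq> N \<and> attach v N D S \<in> strong U E}" using S by (simp add: strong_def)
  qed
  then have "card (Pow N - {{}, N}) \<le> card {S. S \<subseteq> N \<and> attach v N D S \<in> strong U E}"
    by (rule card_mono[rotated]) (rule finite_subset[of _ "Pow N"], use finN in auto)
  moreover have "2 ^ card N - 2 \<le> card (Pow N - {{}, N})"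
  proof -
    have "card (Pow N) - card {{}, N} \<le> card (Pow N - {{}, N})"
      by (rule diff_card_le_card_Diff) simp
    moreover have "card {{}, N} \<le> 2" by (simp add: card_insert_if)
    ultimately show ?thesis using finN by (simp add: card_Pow)
  qed
  ultimately show "2 ^ card N - 2 \<le> card {S. S \<subseteq> N \<and> attach v N D S \<in> strong U E}" by simp
qed

lemma card_ranked_empty: "card (ranked {} E) = 1"
proof -
  have "ranked {} E = {{}}" by (auto simp: ranked_def orients_def)
  then show ?thesis by simp
qed

text \<open>
A closed walk through all vertices certifies that an orientation is strong. Unlike the transitive closure it can
be checked by evaluation.
\<close>

fun walk_in :: "'a rel \<Rightarrow> 'a list \<Rightarrow> bool" where
  "walk_in D (x # y # w) \<longleftrightarrow> (x, y) \<in> D \<and> walk_in D (y # w)"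
| "walk_in D w \<longleftrightarrow> True"

lemma walk_reach:
  assumes "walk_in D w" "i \<le> j" "j < length w"
  shows "(w ! i, w ! j) \<in> D\<^sup>*"
  using assms
proof (induction D w arbitrary: i j rule: walk_in.induct)
  case (1 D x y w)
  have xy: "(x, y) \<in> D" and w: "walk_in D (y # w)" using 1 by auto
  show ?case
  proof (cases j)
    case 0 then show ?thesis using 1 by simp
  next
    case (Suc k)
    show ?thesis
    proof (cases i)
      case 0
      have "((y # w) ! 0, (y # w) ! k) \<in> D\<^sup>*" using w 1 Suc by (intro 1(1)) auto
      then show ?thesis using xy 0 Suc by (auto intro: converse_rtrancl_into_rtrancl)
    next
      case (Suc l)
      then show ?thesis using w 1 \<open>j = Suc k\<close> by auto
    qed
  qed
qed auto

lemma closed_walk_strong: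
  assumes "walk_in D w" "w \<noteq> []" "hd w = last w" "x \<in> set w" "y \<in> set w"
  shows "(x, y) \<in> D\<^sup>*"
proof -
  from assms obtain i j where ij: "i < length w" "x = w ! i" "j < length w" "y = w ! j"
    by (metis in_set_conv_nth)
  have "(w ! i, w ! (length w - 1)) \<in> D\<^sup>*" using assms ij by (intro walk_reach) auto
  moreover have "(w ! 0, w ! j) \<in> D\<^sup>*" using assms ij by (intro walk_reach) auto
  ultimately show ?thesis using assms ij by (simp add: hd_conv_nth last_conv_nth)
qed

section \<open>Strong orientations of graphs on three and four vertices\<close>

text \<open>
The general bound for the deletion of a vertex gives only 4 strong orientations for \<open>K\<^sub>4\<close> minus the edge
\<open>{2, 3}\<close> and 12 for \<open>K\<^sub>4\<close>, which is too few to start the induction. The true numbers 6 and 24 are obtained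
from complete lists, each orientation being paired with a closed walk through all vertices. All orientations
listed for \<open>K\<^sub>4\<close> consist of a Hamiltonian cycle through 0 and two arbitrarily oriented chords.
\<close>

definition diamond_orientations :: "((nat \<times> nat) list \<times> nat list) list" where
  "diamond_orientations =
    [([(0,1),(0,2),(2,1),(1,3),(3,0)], [0,2,1,3,0]), ([(0,1),(1,2),(2,0),(0,3),(3,1)], [0,3,1,2,0]),
     ([(0,1),(1,2),(2,0),(1,3),(3,0)], [0,1,2,0,1,3,0]),
     ([(1,0),(0,2),(2,1),(1,3),(3,0)], [0,2,1,3,0]), ([(1,0),(1,2),(2,0),(0,3),(3,1)], [0,3,1,2,0]),
     ([(1,0),(0,2),(2,1),(0,3),(3,1)], [0,2,1,0,3,1,0])]"

definition k4_orientations :: "((nat \<times> nat) list \<times> nat list) list" where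
  "k4_orientations =
     [([(0,a), (a,b), (b,c), (c,0), e, f], [0,a,b,c,0]).
        (a, b, c) \<leftarrow> [(1,2,3), (1,3,2), (2,1,3), (2,3,1), (3,1,2), (3,2,1)],
        e \<leftarrow> [(0,b), (b,0)], f \<leftarrow> [(a,c), (c,a)]]"

definition diamond_arcs :: "(nat \<times> nat) list" where
  "diamond_arcs = [(0,1),(1,0),(0,2),(2,0),(0,3),(3,0),(1,2),(2,1),(1,3),(3,1)]"

definition valid_orientation :: "nat \<Rightarrow> (nat \<times> nat) list \<Rightarrow> (nat \<times> nat) list \<times> nat list \<Rightarrow> bool" where
  "valid_orientation k F = (\<lambda>(l, w). orients (set l) (set F) \<and>
     walk_in (set l) w \<and> w \<noteq> [] \<and> hd w = last w \<and> set w = set [0..<k])"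

lemma diamond_orientations:
  "list_all (valid_orientation 4 diamond_arcs) diamond_orientations"
  "card (set (map (set \<circ> fst) diamond_orientations)) = 6"
  by code_simp+

lemma k4_orientations:
  "list_all (valid_orientation 4 ((2,3) # (3,2) # diamond_arcs)) k4_orientations"
  "card (set (map (set \<circ> fst) k4_orientations)) = 24"
  by code_simp+

lemma triangle_orientations:
  "list_all (valid_orientation 3 [(0,1),(1,0),(0,2),(2,0),(1,2),(2,1)])
     [([(0,1),(1,2),(2,0)], [0,1,2,0]), ([(1,0),(2,1),(0,2)], [0,2,1,0])]"
  "card (set (map (set \<circ> fst) [([(0::nat,1::nat),(1,2),(2,0)], [0::nat,1,2,0]),
     ([(1,0),(2,1),(0,2)], [0,2,1,0])])) = 2"
  by code_simp+

text \<open>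
Transfer of such a list along an injection \<open>g\<close> of \<open>{..<k}\<close> into the vertex type.
\<close>

lemma card_strong_of_list:
  fixes g :: "nat \<Rightarrow> 'a"
  assumes W: "W = set [0..<k]" and inj: "inj_on g W" and F: "set F \<subseteq> W \<times> W"
    and EF: "Restr E (g ` W) = map_prod g g ` set F"
    and L: "list_all (valid_orientation k F) L"
  shows "card (set (map (set \<circ> fst) L)) \<le> card (strong (g ` W) E)"
proof -
  let ?\<phi> = "\<lambda>R. map_prod g g ` R"
  have injp: "inj_on (map_prod g g) (W \<times> W)" by (rule map_prod_inj_on[OF inj inj])
  have sub: "set l \<subseteq> W \<times> W" if "(l, w) \<in> set L" for l w
  proof -
    have "orients (set l) (set F)" using L that by (auto simp: list_all_iff valid_orientation_def)
    then show ?thesis using F orients_subset by blast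
  qed
  have conv: "(?\<phi> R)\<inverse> = ?\<phi> (R\<inverse>)" for R by auto
  have "?\<phi> ` set (map (set \<circ> fst) L) \<subseteq> strong (g ` W) E"
  proof safe
    fix R assume "R \<in> set (map (set \<circ> fst) L)"
    then obtain l w where lw: "(l, w) \<in> set L" and R: "R = set l" by auto
    have v: "orients R (set F)" "walk_in R w" "w \<noteq> []" "hd w = last w" "set w = W"
      using L lw R W by (auto simp: list_all_iff valid_orientation_def)
    have RW: "R \<subseteq> W \<times> W" "R\<inverse> \<subseteq> W \<times> W" using sub[OF lw] R by blast+
    have "?\<phi> R \<inter> ?\<phi> (R\<inverse>) = ?\<phi> (R \<inter> R\<inverse>)"
      by (rule inj_on_image_Int[OF injp RW, symmetric])
    then have "orients (?\<phi> R) (Restr E (g ` W))"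
      using v(1) unfolding EF orients_def conv image_Un[symmetric] by simp
    moreover have "(g a, g b) \<in> (?\<phi> R)\<^sup>*" if "a \<in> W" "b \<in> W" for a b
    proof -
      have "(a, b) \<in> R\<^sup>*" using closed_walk_strong[OF v(2-4)] that v(5) by blast
      then show ?thesis
      proof (induction rule: rtrancl_induct)
        case (step y z)
        have "(g y, g z) \<in> ?\<phi> R" using step.hyps(2) by force
        then show ?case using step.IH by (rule rtrancl_into_rtrancl[rotated])
      qed simp
    qed
    ultimately show "?\<phi> R \<in> strong (g ` W) E" unfolding strong_def by blast
  qed
  moreover have "inj_on ?\<phi> (set (map (set \<circ> fst) L))"
  proof (rule inj_on_image, rule inj_on_subset[OF injp])
    show "\<Union> (set (map (set \<circ> fst) L)) \<subseteq> W \<times> W" using sub by fastforce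
  qed
  ultimately show ?thesis using W by (intro card_inj_on_le finite_strong) auto
qed

lemma card_strong_four:
  assumes d: "distinct [x, y, p, q]" and E: "sym E" "irrefl E"
    and arcs: "(x, y) \<in> E" "(x, p) \<in> E" "(x, q) \<in> E" "(y, p) \<in> E" "(y, q) \<in> E"
  shows "(if (p, q) \<in> E then 24 else 6) \<le> card (strong {x, y, p, q} E)"
proof -
  define g where "g i = [x, y, p, q] ! i" for i
  have W4: "{0, 1, 2, 3} = set [0..<4::nat]" by code_simp
  define F where "F = (if (p, q) \<in> E then (2,3) # (3,2) # diamond_arcs else diamond_arcs)"
  have g: "g 0 = x" "g 1 = y" "g (Suc 0) = y" "g 2 = p" "g 3 = q" by (simp_all add: g_def)
  have img: "g ` {0, 1, 2, 3} = {x, y, p, q}" by (simp add: g)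
  have inj: "inj_on g {0, 1, 2, 3}" using d by (auto simp: inj_on_def g)
  have sy: "(b, a) \<in> E \<longleftrightarrow> (a, b) \<in> E" for a b using E(1) by (auto simp: sym_def)
  have ir: "(a, a) \<notin> E" for a using E(2) by (auto simp: irrefl_def)
  have "Restr E {x, y, p, q} = map_prod g g ` set F"
  proof (rule set_eqI, clarify)
    fix a b
    show "(a, b) \<in> Restr E {x, y, p, q} \<longleftrightarrow> (a, b) \<in> map_prod g g ` set F"
      unfolding F_def diamond_arcs_def using d arcs arcs[THEN sy[THEN iffD2]] ir
      by (auto simp: g sy[of q p])
  qed
  then have EF: "Restr E (g ` {0, 1, 2, 3}) = map_prod g g ` set F" unfolding img .
  have F: "set F \<subseteq> {0, 1, 2, 3} \<times> {0, 1, 2, 3}" by (auto simp: F_def diamond_arcs_def)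
  note le = card_strong_of_list[OF W4 inj F EF, unfolded img]
  show ?thesis
  proof (cases "(p, q) \<in> E")
    case True
    then show ?thesis using le[of k4_orientations] k4_orientations by (simp add: F_def)
  next
    case False
    then show ?thesis using le[of diamond_orientations] diamond_orientations by (simp add: F_def)
  qed
qed

lemma card_strong_triangle:
  assumes d: "distinct [x, y, p]" and E: "sym E" "irrefl E"
    and arcs: "(x, y) \<in> E" "(x, p) \<in> E" "(y, p) \<in> E"
  shows "2 \<le> card (strong {x, y, p} E)"
proof -
  define g where "g i = [x, y, p] ! i" for i
  let ?F = "[(0,1),(1,0),(0,2),(2,0),(1,2),(2,1)] :: (nat \<times> nat) list"
  have g: "g 0 = x" "g 1 = y" "g (Suc 0) = y" "g 2 = p" by (simp_all add: g_def)
  have img: "g ` {0, 1, 2} = {x, y, p}" by (simp add: g)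
  have inj: "inj_on g {0, 1, 2}" using d by (auto simp: inj_on_def g)
  have W: "{0, 1, 2} = set [0..<3::nat]" by code_simp
  have sy: "(b, a) \<in> E \<longleftrightarrow> (a, b) \<in> E" for a b using E(1) by (auto simp: sym_def)
  have ir: "(a, a) \<notin> E" for a using E(2) by (auto simp: irrefl_def)
  have "Restr E {x, y, p} = map_prod g g ` set ?F"
  proof (rule set_eqI, clarify)
    fix a b
    show "(a, b) \<in> Restr E {x, y, p} \<longleftrightarrow> (a, b) \<in> map_prod g g ` set ?F"
      using d arcs arcs[THEN sy[THEN iffD2]] ir by (auto simp: g)
  qed
  then have EF: "Restr E (g ` {0, 1, 2}) = map_prod g g ` set ?F" unfolding img .
  have F: "set ?F \<subseteq> {0, 1, 2} \<times> {0, 1, 2}" by auto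
  show ?thesis
    using card_strong_of_list[OF W inj F EF triangle_orientations(1)] triangle_orientations(2)
    unfolding img by simp
qed

section \<open>Numerical estimates\<close>

text \<open>
From \<open>e\<close> to \<open>e + 1\<close> the right-hand side at least doubles. The left-hand side grows by the factor
\<open>(1 + 1 / s)\<^sup>2 (s + e + 2) / (s + e + 1)\<close>, which is at most 2, except for \<open>s = 3\<close> and \<open>e < 4\<close>; these cases are computed.
\<close>

lemma growth_three:
  fixes s e :: nat
  assumes "3 \<le> s"
  shows "(2 ^ s - 2) * (1 + 1 / real s) ^ (2 * e) * (1 + e / (s + 1)) \<le> 2 ^ (s + e) - 2"
proof -
  define L where "L e = (2 ^ s - 2) * (1 + 1 / real s) ^ (2 * e) * (1 + real e / (s + 1))" for e
  define R where "R e = (2 ^ (s + e) - 2 :: real)" for e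
  have p2: "2 \<le> (2::real) ^ s" using power_increasing[of 1 s "2::real"] assms by simp
  have Lnn: "0 \<le> L e" for e unfolding L_def using p2 by (intro mult_nonneg_nonneg) auto
  have step: "L (Suc e) = L e * ((1 + 1 / real s)\<^sup>2 * ((s + e + 2) / (s + e + 1)))" for e
  proof -
    have "1 + real (Suc e) / (s + 1) = (1 + real e / (s + 1)) * ((s + e + 2) / (s + e + 1))"
    proof -
      have 1: "1 + real (Suc e) / (s + 1) = (s + e + 2) / (s + 1)"
        and 2: "1 + real e / (s + 1) = (s + e + 1) / (s + 1)" by (simp_all add: field_simps)
      have 3: "real (s + e + 1) \<noteq> 0" by linarith
      show ?thesis unfolding 1 2 times_divide_times_eq using 3
        by (metis mult.commute mult_divide_mult_cancel_left)
    qed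
    then show ?thesis by (simp add: L_def power2_eq_square)
  qed
  have R: "2 * R e \<le> R (Suc e)" for e by (simp add: R_def)
  have next_e: "L (Suc e) \<le> R (Suc e)"
    if "L e \<le> R e" "(1 + 1 / real s)\<^sup>2 * ((s + e + 2) / (s + e + 1)) \<le> 2" for e
  proof -
    have "L (Suc e) \<le> L e * 2" unfolding step using that Lnn by (intro mult_left_mono) auto
    then show ?thesis using that R[of e] by linarith
  qed
  have "L e \<le> R e"
  proof (cases "s = 3")
    case True
    consider "e = 0" | "e = 1" | "e = 2" | "e = 3" | "4 \<le> e" by linarith
    then show ?thesis
    proof cases
      case 5
      then show ?thesis
      proof (induction e rule: dec_induct)
        case base show ?case by (simp add: L_def R_def True power_divide)
      next
        case (step n)
        show ?case by (rule next_e[OF step.IH]) (use step True in \<open>simp add: field_simps power2_eq_square\<close>)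
      qed
    qed (simp_all add: L_def R_def True power_divide power_numeral_reduce)
  next
    case False
    then have s4: "4 \<le> s" using assms by simp
    show ?thesis
    proof (induction e)
      case 0 show ?case by (simp add: L_def R_def)
    next
      case (Suc e)
      show ?case
      proof (rule next_e[OF Suc])
        have "(1 + 1 / real s)\<^sup>2 \<le> (5 / 4)\<^sup>2" using s4 by (intro power_mono) (auto simp: field_simps)
        moreover have "(s + e + 2) / real (s + e + 1) \<le> 6 / 5" using s4 by (simp add: field_simps)
        ultimately have "(1 + 1 / real s)\<^sup>2 * ((s + e + 2) / (s + e + 1)) \<le> (5 / 4)\<^sup>2 * (6 / 5)"
          by (intro mult_mono) auto
        also have "\<dots> \<le> 2" by (simp add: power2_eq_square)
        finally show "(1 + 1 / real s)\<^sup>2 * ((s + e + 2) / (s + e + 1)) \<le> 2" .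
      qed
    qed
  qed
  then show ?thesis by (simp add: L_def R_def)
qed

text \<open>
The number \<open>\<phi>\<close> is the factor of \<open>forest_sum_add_vertex\<close> for \<open>r = 1 / s\<close>. As far as these
bounds go, the step from \<open>G - v\<close> to \<open>G\<close> is worst when \<open>v\<close> has no neighbour in its own part.
\<close>

lemma vertex_factor_three:
  fixes s e :: nat and \<phi> :: real
  assumes s: "3 \<le> s"
  defines "\<phi> \<equiv> real s * (1 + 1 / s) ^ e + e * (1 + 1 / s) ^ (e - 1)"
  shows "real (s + 1) * (2 ^ s - 2) * \<phi>\<^sup>2 \<le> real (s + e + 1) * (2 ^ (s + e) - 2) * (real s)\<^sup>2"
proof -
  have phi: "\<phi> = s * (1 + 1 / s) ^ e * (1 + e / (s + 1))"
  proof (cases e)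
    case (Suc k)
    define q where "q = 1 + 1 / real s"
    have "s * q = s + 1" using s by (simp add: q_def field_simps)
    then have "real s * q ^ e = q ^ k * (s + 1)" unfolding Suc by (metis mult.assoc mult.commute power_Suc)
    then have "q ^ k = s * q ^ e / (s + 1)" by (simp add: field_simps)
    then have "\<phi> = s * q ^ e + e * (s * q ^ e / (s + 1))"
      unfolding \<phi>_def q_def[symmetric] using Suc by simp
    then show ?thesis unfolding q_def[symmetric] by (simp add: algebra_simps)
  qed (simp add: \<phi>_def)
  have "real (s + 1) * (2 ^ s - 2) * \<phi>\<^sup>2 = (real s)\<^sup>2 * (real (s + 1) * (1 + e / (s + 1)))
      * ((2 ^ s - 2) * (1 + 1 / real s) ^ (2 * e) * (1 + e / (s + 1)))"
    unfolding phi by (simp add: power_mult_distrib power2_eq_square power_mult mult_ac power_add mult_2)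
  also have "\<dots> \<le> (real s)\<^sup>2 * (real (s + 1) * (1 + e / (s + 1))) * (2 ^ (s + e) - 2)"
    by (intro mult_left_mono growth_three[OF s]) auto
  also have "real (s + 1) * (1 + e / (s + 1)) = real (s + e + 1)" by (simp add: field_simps)
  finally show ?thesis by (simp add: mult_ac)
qed

text \<open>
The estimate \<open>exp x \<le> 1 + x + x\<^sup>2\<close> is used at \<open>x = 1 / 64\<close> and raised to the fourth power three times.
\<close>

lemma exp_one_le: "exp (1::real) \<le> 27395 / 10000"
proof -
  have "exp (1 / 64 :: real) \<le> 101587 / 100000"
    using exp_bound[of "1 / 64 :: real"] by (simp add: power2_eq_square)
  then have "exp (1 / 64 :: real) ^ 4 \<le> (101587 / 100000) ^ 4" by (intro power_mono) auto
  then have "exp (1 / 16 :: real) \<le> 106501 / 100000"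
    unfolding exp_of_nat_mult[symmetric] by (simp add: power_divide)
  then have "exp (1 / 16 :: real) ^ 4 \<le> (106501 / 100000) ^ 4" by (intro power_mono) auto
  then have "exp (1 / 4 :: real) \<le> 128652 / 100000"
    unfolding exp_of_nat_mult[symmetric] by (simp add: power_divide)
  then have "exp (1 / 4 :: real) ^ 4 \<le> (128652 / 100000) ^ 4" by (intro power_mono) auto
  then show ?thesis
    unfolding exp_of_nat_mult[symmetric] by (simp add: power_divide)
qed

lemma exp_three_less: "exp (3::real) < 62 / 3"
  and exp_two_less: "exp (2::real) < 151 / 20"
proof -
  have "exp (1::real) ^ 3 \<le> (27395 / 10000) ^ 3" "exp (1::real) ^ 2 \<le> (27395 / 10000) ^ 2"
    by (intro power_mono exp_one_le; simp)+
  then show "exp (3::real) < 62 / 3" "exp (2::real) < 151 / 20"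
    unfolding exp_of_nat_mult[symmetric] by (simp_all add: power_divide)
qed

text \<open>
With two dominating vertices outside \<open>A\<close> the choice \<open>r = 1 / s = 1 / 2\<close> is too weak for \<open>e = 2\<close>. The smaller \<open>r\<close>
belongs to a vertex all of whose \<open>e\<close> neighbours in \<open>A\<close> have at least \<open>e - 1\<close> further neighbours there.
Equality holds for \<open>e = 0\<close> and \<open>e = 1\<close>. From \<open>e = 6\<close> on, \<open>(1 + r) ^ (2 * e) \<le> exp 3\<close> suffices.
\<close>

lemma vertex_factor_two:
  fixes e :: nat and r \<phi> :: real
  defines "r \<equiv> 3 / (2 * (e + 2))"
  defines "\<phi> \<equiv>  2 * (1 + r) ^ e + e * (1 + r) ^ (e - 1)"
  shows "3 / 2 * \<phi>\<^sup>2 \<le> real (e + 3) * (2 ^ (e + 2) - 2)"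
proof -
  consider "e = 0" | "e = 1" | "e = 2" | "e = 3" | "e = 4" | "e = 5" | "6 \<le> e" by linarith
  then show ?thesis
  proof cases
    case 7
    define d where "d = e + 2"
    have d: "8 \<le> d" "d = e + 2" using 7 by (auto simp: d_def)
    have r0: "0 \<le> r" by (simp add: r_def)
    have "\<phi> \<le> d * (1 + r) ^ e"
    proof -
      have "(1 + r) ^ (e - 1) \<le> (1 + r) ^ e" using r0 by (intro power_increasing) auto
      then show ?thesis unfolding \<phi>_def d by (simp add: algebra_simps mult_left_mono)
    qed
    moreover have "0 \<le> \<phi>" using r0 by (simp add: \<phi>_def)
    ultimately have "\<phi>\<^sup>2 \<le> (d * (1 + r) ^ e)\<^sup>2" by (intro power_mono) auto
    also have "\<dots> = (real d)\<^sup>2 * (1 + r) ^ (2 * e)" by (simp add: power_mult_distrib power_mult mult.commute)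
    also have "(1 + r) ^ (2 * e) \<le> (1 + r) ^ (2 * d)" using r0 d by (intro power_increasing) auto
    also have "\<dots> \<le> exp r ^ (2 * d)" using r0 by (intro power_mono) auto
    also have "exp r ^ (2 * d) = exp 3"
      unfolding exp_of_nat_mult[symmetric] by (simp add: r_def d field_simps)
    also have "(real d)\<^sup>2 * exp 3 \<le> (real d)\<^sup>2 * (62 / 3)" using exp_three_less by (intro mult_left_mono) auto
    finally have "\<phi>\<^sup>2 \<le> (real d)\<^sup>2 * (62 / 3)" by (simp add: mult_left_mono)
    then have "3 / 2 * \<phi>\<^sup>2 \<le> real d * (31 * real d)" by (simp add: power2_eq_square)
    moreover have "31 * real d \<le> 2 ^ d - 2"
      using d(1) by (induction d rule: dec_induct) auto
    then have "real d * (31 * real d) \<le> (real d + 1) * (2 ^ d - 2)" by (intro mult_mono) auto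
    ultimately show ?thesis using d by (simp add: algebra_simps)
  qed (simp_all add: r_def \<phi>_def power2_eq_square power_numeral_reduce)
qed

text \<open>
The loss against \<open>beta n\<close> that the induction can incur. The ratios of consecutive values are rounded down from the
worst cases \<open>K\<^sub>1\<^sub>,\<^sub>2\<^sub>,\<^sub>2\<close> for \<open>n = 5\<close>, \<open>K\<^sub>2\<^sub>,\<^sub>2\<^sub>,\<^sub>2\<close> for \<open>n = 6\<close> and \<open>K\<^sub>1\<^sub>,\<^sub>3\<^sub>,\<^sub>3\<close> for \<open>n = 7\<close>; from \<open>n = 8\<close> on the loss is regained.
\<close>

definition kappa :: "nat \<Rightarrow> real" where
  "kappa n = (if n = 5 then 79/100 else if n = 6 then 72/100 else if n = 7 then 66/100
     else if n = 8 then 78/100 else if n = 9 then 98/100 else 1)"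

text \<open>
Here \<open>s = b + c\<close>, and \<open>Y\<close> is a lower bound for \<open>a + b\<close> and \<open>a + c\<close> when \<open>A\<close> is a largest part.
Up to \<open>n = 9\<close> there are twelve pairs \<open>(a, s)\<close>. Beyond that, small \<open>s\<close> forces a large \<open>Y\<close>, and for
\<open>s \<ge> 7\<close> the power is at most \<open>exp 2\<close>.
\<close>

lemma kappa_step:
  fixes a s :: nat
  assumes s: "3 \<le> s" "s \<le> 2 * a" and Y: "Y = max s (a + 1)"
  shows "kappa (a + s) * (3 / 2) * (real Y / (real Y - 1)) ^ (2 * (s - 2)) * (real s)\<^sup>2
           \<le> kappa (a + s - 1) * (real (s + 1) * (2 ^ s - 2))"
proof (cases "a + s \<le> 9")
  case True
  then have "(a, s) \<in> {(2,3), (3,3), (4,3), (5,3), (6,3), (2,4), (3,4), (4,4), (5,4), (3,5), (4,5), (3,6)}"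
    using s by (simp, presburger)
  then show ?thesis unfolding Y by (auto simp: kappa_def power_divide power_numeral_reduce)
next
  case False
  then have k: "kappa (a + s) = 1" "98 / 100 \<le> kappa (a + s - 1)" by (auto simp: kappa_def)
  have Y1: "1 < real Y" using s Y by simp
  have ratio: "real Y / (real Y - 1) \<le> c / (c - 1)" if "1 < c" "c \<le> real Y" for c
    using that by (simp add: field_simps)
  have main: "(3 / 2) * (real Y / (real Y - 1)) ^ (2 * (s - 2)) * (real s)\<^sup>2
      \<le> 98 / 100 * (real (s + 1) * (2 ^ s - 2))"
  proof -
    have fixed: ?thesis
      if c: "1 < c" "c \<le> real Y"
        and num: "(3 / 2) * (c / (c - 1)) ^ (2 * (s - 2)) * (real s)\<^sup>2 \<le> 98 / 100 * (real (s + 1) * (2 ^ s - 2))"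
      for c
    proof -
      have "(real Y / (real Y - 1)) ^ (2 * (s - 2)) \<le> (c / (c - 1)) ^ (2 * (s - 2))"
        using ratio[OF c] Y1 by (intro power_mono) auto
      then have "(3 / 2) * (real Y / (real Y - 1)) ^ (2 * (s - 2)) * (real s)\<^sup>2
          \<le> (3 / 2) * (c / (c - 1)) ^ (2 * (s - 2)) * (real s)\<^sup>2"
        by (intro mult_right_mono mult_left_mono) auto
      then show ?thesis using num by linarith
    qed
    consider "s = 3" | "s = 4" | "s = 5" | "s = 6" | "7 \<le> s" using s by linarith
    then show ?thesis
    proof cases
      case 1 show ?thesis by (rule fixed[of 8]) (use 1 False Y in \<open>auto simp: power_divide power_numeral_reduce\<close>)
    next
      case 2 show ?thesis by (rule fixed[of 7]) (use 2 False Y in \<open>auto simp: power_divide power_numeral_reduce\<close>)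
    next
      case 3 show ?thesis by (rule fixed[of 6]) (use 3 False Y in \<open>auto simp: power_divide power_numeral_reduce\<close>)
    next
      case 4 show ?thesis by (rule fixed[of 6]) (use 4 False Y in \<open>auto simp: power_divide power_numeral_reduce\<close>)
    next
      case 5
      show ?thesis
      proof (rule fixed[of "real s"])
        show "1 < real s" "real s \<le> real Y" using 5 Y by auto
        have base: "real s / (real s - 1) = 1 + 1 / real (s - 1)" using 5 by (simp add: field_simps of_nat_diff)
        have "(real s / (real s - 1)) ^ (2 * (s - 2)) \<le> (real s / (real s - 1)) ^ (2 * (s - 1))"
          using 5 by (intro power_increasing) (auto simp: field_simps)
        also have "\<dots> = (1 + 1 / real (s - 1)) ^ (2 * (s - 1))" by (simp only: base)
        also have "\<dots> \<le> exp (1 / real (s - 1)) ^ (2 * (s - 1))"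
          by (intro power_mono) auto
        also have "\<dots> = exp 2"
        proof -
          have pw: "exp (1 / real m) ^ (2 * m) = exp 2" if "m \<noteq> 0" for m :: nat
            unfolding exp_of_nat_mult[symmetric] using that by simp
          show ?thesis by (rule pw) (use 5 in simp)
        qed
        also have "\<dots> \<le> 151 / 20" using exp_two_less by simp
        finally have "(3 / 2) * (real s / (real s - 1)) ^ (2 * (s - 2)) * (real s)\<^sup>2
            \<le> (3 / 2) * (151 / 20) * (real s)\<^sup>2" by (intro mult_right_mono mult_left_mono) auto
        also have "\<dots> \<le> 98 / 100 * (real s * (12 * real s))" by (simp add: power2_eq_square)
        also have "12 * real s \<le> 2 ^ s - 2" using 5 by (induction s rule: dec_induct) auto
        then have "98 / 100 * (real s * (12 * real s)) \<le> 98 / 100 * (real (s + 1) * (2 ^ s - 2))"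
          by (intro mult_left_mono mult_mono) auto
        finally show "(3 / 2) * (real s / (real s - 1)) ^ (2 * (s - 2)) * (real s)\<^sup>2
            \<le> 98 / 100 * (real (s + 1) * (2 ^ s - 2))" .
      qed
    qed
  qed
  have "(2::real) ^ 1 \<le> 2 ^ s" using s by (intro power_increasing) auto
  then have "98 / 100 * (real (s + 1) * (2 ^ s - 2)) \<le> kappa (a + s - 1) * (real (s + 1) * (2 ^ s - 2))"
    using k by (intro mult_right_mono) auto
  with main show ?thesis unfolding k(1) mult_1_left by (rule order_trans)
qed

text \<open>
The lower bound of the theorem.
\<close>

definition beta :: "nat \<Rightarrow> real" where
  "beta n = 27 / (real n)\<^sup>2 * (3 / 2) ^ (n - 4)"

lemma beta_step:
  assumes "5 \<le> n"
  shows "beta n * (real n)\<^sup>2 = 3 / 2 * beta (n - 1) * (real (n - 1))\<^sup>2"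
proof -
  have "n - 4 = Suc (n - 1 - 4)" using assms by simp
  then show ?thesis using assms by (simp add: beta_def)
qed

lemma kappa_beta_gt_1:
  assumes "4 \<le> n"
  shows "1 < kappa n * beta n"
proof (cases "n \<le> 9")
  case True
  then have "n \<in> {4, 5, 6, 7, 8, 9}" using assms by auto
  then show ?thesis by (auto simp: kappa_def beta_def power_divide power_numeral_reduce)
next
  case False
  then have n: "10 \<le> n" by simp
  then have "(real n)\<^sup>2 < 27 * (3 / 2) ^ (n - 4)"
  proof (induction n rule: dec_induct)
    case base show ?case by (simp add: power_divide power_numeral_reduce)
  next
    case (step n)
    have "(real (Suc n))\<^sup>2 \<le> 3 / 2 * (real n)\<^sup>2"
    proof -
      have "10 * real n \<le> real n * real n" using step by (intro mult_right_mono) auto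
      then have "2 + 4 * real n \<le> real n * real n" using step(1) by linarith
      then show ?thesis by (simp add: power2_eq_square algebra_simps)
    qed
    moreover have "Suc n - 4 = Suc (n - 4)" using step by simp
    ultimately show ?case using step.IH by simp
  qed
  then show ?thesis using n by (simp add: kappa_def beta_def field_simps)
qed

section \<open>Orientations and spanning trees of pair graphs\<close>

lemma pair_graph_arcs:
  assumes "pair_graph G"
  shows "finite (pverts G)" "finite (parcs G)" "sym (parcs G)" "irrefl (parcs G)"
    "parcs G \<subseteq> pverts G \<times> pverts G" "Restr (parcs G) (pverts G) = parcs G"
proof -
  interpret pair_graph G by fact
  show "finite (pverts G)" "finite (parcs G)" by (rule pair_finite_verts pair_finite_arcs)+
  show "sym (parcs G)" using arcs_symmetric by (auto simp: sym_def)
  show "irrefl (parcs G)" using pair_no_loops by (force simp: irrefl_def)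
  show "parcs G \<subseteq> pverts G \<times> pverts G" using wellformed' by auto
  then show "Restr (parcs G) (pverts G) = parcs G" by blast
qed

lemma pair_graphI:
  assumes "finite (pverts T)" "sym (parcs T)" "irrefl (parcs T)" "parcs T \<subseteq> pverts T \<times> pverts T"
  shows "pair_graph T"
proof -
  have "finite (parcs T)" using assms by (meson finite_SigmaI finite_subset)
  then show ?thesis
    using assms by unfold_locales (auto simp: symmetric_def irrefl_def)
qed

lemma pcas_increasing:
  fixes h :: "'a \<Rightarrow> nat"
  assumes "pcas u p v" "set p \<subseteq> D" "p \<noteq> []" "\<And>x y. (x, y) \<in> D \<Longrightarrow> h x < h y"
  shows "h u < h v"
  using assms(1-3)
proof (induction p arbitrary: u)
  case (Cons e p)
  have "h (fst e) < h (snd e)" using Cons.prems(2) assms(4)[of "fst e" "snd e"] by (cases e) simp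
  then show ?case using Cons by (cases "p = []") force+
qed simp

lemma orientation_iff_orients:
  assumes "pair_graph G"
  shows "orientation D G \<longleftrightarrow> pverts D = pverts G \<and> orients (parcs D) (Restr (parcs G) (pverts G))"
  by (simp add: orientation_def orients_def pair_graph_arcs[OF assms])

lemma finite_orientations:
  assumes "pair_graph G"
  shows "finite {D. orientation D G}"
proof -
  let ?f = "\<lambda>D. \<lparr>pverts = pverts G, parcs = D\<rparr>"
  have "{D. orientation D G} \<subseteq> ?f ` {D. orients D (Restr (parcs G) (pverts G))}"
    unfolding orientation_iff_orients[OF assms] by (auto intro!: image_eqI)
  moreover have "finite {D. orients D (Restr (parcs G) (pverts G))}"
    by (rule finite_orients) (simp add: pair_graph_arcs[OF assms])
  ultimately show ?thesis by (meson finite_imageI finite_subset)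
qed

lemma card_ranked_le_num_acyclic_orientations:
  assumes G: "pair_graph G"
  shows "card (ranked (pverts G) (parcs G)) \<le> num_acyclic_orientations G"
  unfolding num_acyclic_orientations_def
proof (rule card_inj_on_le)
  let ?f = "\<lambda>D. \<lparr>pverts = pverts G, parcs = D\<rparr>"
  show "inj_on ?f (ranked (pverts G) (parcs G))" by (auto simp: inj_on_def)
  show "finite {D. acyclic_orientation D G}"
    by (rule finite_subset[OF _ finite_orientations[OF G]]) (auto simp: acyclic_orientation_def)
  show "?f ` ranked (pverts G) (parcs G) \<subseteq> {D. acyclic_orientation D G}"
  proof safe
    fix D assume D: "D \<in> ranked (pverts G) (parcs G)"
    then obtain h :: "'a \<Rightarrow> nat" where h: "\<And>x y. (x, y) \<in> D \<Longrightarrow> h x < h y"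
      by (auto simp: ranked_def)
    have "\<not> pre_digraph.cycle (with_proj (?f D)) p" for p
    proof
      assume "pre_digraph.cycle (with_proj (?f D)) p"
      then obtain u where "pcas u p u" "set p \<subseteq> D" "p \<noteq> []"
        by (auto simp: pre_digraph.cycle_def pre_digraph.awalk_def cas_with_proj_eq)
      then have "h u < h u" using h by (rule pcas_increasing)
      then show False by simp
    qed
    then show "acyclic_orientation (?f D) G"
      using D by (simp add: acyclic_orientation_def orientation_iff_orients[OF G] ranked_def)
  qed
qed

lemma card_strong_le_num_totally_cyclic_orientations:
  assumes G: "pair_graph G"
  shows "card (strong (pverts G) (parcs G)) \<le> num_totally_cyclic_orientations G"
  unfolding num_totally_cyclic_orientations_def
proof (rule card_inj_on_le)
  let ?f = "\<lambda>D. \<lparr>pverts = pverts G, parcs = D\<rparr>"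
  show "inj_on ?f (strong (pverts G) (parcs G))" by (auto simp: inj_on_def)
  show "finite {D. totally_cyclic_orientation D G}"
    by (rule finite_subset[OF _ finite_orientations[OF G]]) (auto simp: totally_cyclic_orientation_def)
  show "?f ` strong (pverts G) (parcs G) \<subseteq> {D. totally_cyclic_orientation D G}"
  proof safe
    fix D assume D: "D \<in> strong (pverts G) (parcs G)"
    then have o: "orients D (Restr (parcs G) (pverts G))" by (simp add: strong_def)
    then have DV: "D \<subseteq> pverts G \<times> pverts G" using orients_subset by blast
    interpret D: pair_wf_digraph "?f D" by unfold_locales (use DV in auto)
    have "\<exists>p. pre_digraph.cycle (with_proj (?f D)) p \<and> e \<in> set p" if e: "e \<in> D" for e
    proof -
      obtain a b where ab: "e = (a, b)" by (cases e)
      have V: "a \<in> pverts G" "b \<in> pverts G" using e ab DV by auto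
      then have "(b, a) \<in> D\<^sup>*" using D by (auto simp: strong_def)
      then have "b \<rightarrow>\<^sup>*\<^bsub>with_proj (?f D)\<^esub> a" using V by (simp add: D.reachable_conv)
      then obtain q where q: "D.apath b q a" by (auto simp: D.reachable_apath)
      then have "D.awalk a (e # q) a"
        using e ab V by (auto simp: D.apath_def D.awalk_Cons_iff)
      moreover have "distinct (tl (pawalk_verts a (e # q)))"
        using q ab by (simp add: D.apath_def)
      ultimately have "D.cycle (e # q)" unfolding D.cycle_def by blast
      then show ?thesis by (intro exI[of _ "e # q"]) simp
    qed
    then show "totally_cyclic_orientation (?f D) G"
      using o by (simp add: totally_cyclic_orientation_def orientation_iff_orients[OF G])
  qed
qed

text \<open>
The undirected graph of a parent function.
\<close>

definition parent_arcs :: "'a set \<Rightarrow> ('a \<Rightarrow> 'a) \<Rightarrow> 'a rel" where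
  "parent_arcs V f = {(x, y). x \<in> V \<and> y \<in> V \<and> x \<noteq> y \<and> (y = f x \<or> x = f y)}"

text \<open>
Every vertex other than \<open>r\<close> chooses a neighbour that is closer to \<open>r\<close>.
\<close>

lemma parent_function_exists:
  assumes r: "r \<in> V" and P: "P \<subseteq> V \<times> V" and reach: "\<And>x. x \<in> V \<Longrightarrow> (x, r) \<in> P\<^sup>*"
  obtains f where "f \<in> forests V" "f r = r" "\<And>x. x \<in> V - {r} \<Longrightarrow> (x, f x) \<in> P \<and> f x \<noteq> x"
proof -
  define d where "d x = (LEAST n. (x, r) \<in> P ^^ n)" for x
  have "\<exists>y. (x, y) \<in> P \<and> d y < d x" if x: "x \<in> V - {r}" for x
  proof -
    have "\<exists>n. (x, r) \<in> P ^^ n" using reach x rtrancl_imp_relpow by blast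
    then have n: "(x, r) \<in> P ^^ d x" unfolding d_def by (rule LeastI_ex)
    then obtain k where k: "d x = Suc k" using x by (cases "d x") auto
    then obtain y where y: "(x, y) \<in> P" "(y, r) \<in> P ^^ k" using n by (metis relpow_Suc_D2)
    then have "d y \<le> k" unfolding d_def by (intro Least_le)
    then show ?thesis using y k by auto
  qed
  then obtain g where g: "\<And>x. x \<in> V - {r} \<Longrightarrow> (x, g x) \<in> P \<and> d (g x) < d x" by metis
  let ?f = "restrict (\<lambda>x. if x = r then r else g x) V"
  have fx: "?f x = g x" if "x \<in> V - {r}" for x using that by simp
  show thesis
  proof
    show "?f \<in> forests V"
    proof (rule forestsI[where h = d])
      show "?f \<in> V \<rightarrow>\<^sub>E V" using g P r by fastforce
      fix x assume "x \<in> V" "?f x \<noteq> x"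
      then have x: "x \<in> V - {r}" using r by (auto split: if_splits)
      then show "d (?f x) < d x" using g[OF x] fx[OF x] by simp
    qed
    show "?f r = r" using r by simp
    fix x assume x: "x \<in> V - {r}"
    then show "(x, ?f x) \<in> P \<and> ?f x \<noteq> x" using g[OF x] fx[OF x] by auto
  qed
qed

lemma forest_reaches_root:
  assumes f: "f \<in> forests V" and root: "\<And>x. x \<in> V - {r} \<Longrightarrow> f x \<noteq> x" and x: "x \<in> V"
  shows "(x, r) \<in> (parent_arcs V f)\<^sup>*"
proof -
  from f obtain h :: "'a \<Rightarrow> nat" where fV: "f \<in> V \<rightarrow>\<^sub>E V" and
    h: "\<And>x. x \<in> V \<Longrightarrow> f x \<noteq> x \<Longrightarrow> h (f x) < h x" by (rule forestsE) blast
  show ?thesis using x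
  proof (induction "h x" arbitrary: x rule: less_induct)
    case less
    show ?case
    proof (cases "x = r")
      case False
      then have ne: "f x \<noteq> x" using root less.prems by simp
      have V: "f x \<in> V" using PiE_mem[OF fV less.prems] .
      have "(f x, r) \<in> (parent_arcs V f)\<^sup>*" by (rule less.hyps[OF h[OF less.prems ne] V])
      moreover have "(x, f x) \<in> parent_arcs V f" using ne V less.prems by (auto simp: parent_arcs_def)
      ultimately show ?thesis by (rule converse_rtrancl_into_rtrancl[rotated])
    qed simp
  qed
qed

lemma sym_parent_arcs: "sym (parent_arcs V f)"
  by (auto simp: parent_arcs_def sym_def)

lemma parent_arcs_subset:
  assumes "sym P" "f r = r" and par: "\<And>x. x \<in> V - {r} \<Longrightarrow> (x, f x) \<in> P"
  shows "parent_arcs V f \<subseteq> P"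
proof -
  have arc: "(x, f x) \<in> P" if "x \<in> V" "f x \<noteq> x" for x
    using par[of x] that assms(2) by (cases "x = r") auto
  have "(x, y) \<in> P" if "(x, y) \<in> parent_arcs V f" for x y
    using that arc[of x] symD[OF assms(1) arc[of y]] by (auto simp: parent_arcs_def)
  then show ?thesis by auto
qed

lemma connected_with_proj:
  assumes "pair_graph T"
  shows "connected (with_proj T) \<longleftrightarrow> pverts T \<noteq> {} \<and> (\<forall>x\<in>pverts T. \<forall>y\<in>pverts T. (x, y) \<in> (parcs T)\<^sup>*)"
proof -
  interpret T: pair_graph T by fact
  have "(parcs T)\<^sup>s = parcs T" using pair_graph_arcs(3)[OF assms] by (auto simp: symcl_def sym_def)
  moreover have "(x, y) \<in> rtrancl_on (pverts T) (parcs T) \<longleftrightarrow> (x, y) \<in> (parcs T)\<^sup>*"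
    if "x \<in> pverts T" "y \<in> pverts T" for x y
    using T.reachable_conv[of x y] that unfolding reachable_def by simp
  ultimately show ?thesis unfolding connected_conv by simp
qed

lemma pawalk_verts_snoc: "pcas u p v \<Longrightarrow> pawalk_verts u (p @ [(v, x)]) = pawalk_verts u p @ [x]"
  by (induction p arbitrary: u) auto

text \<open>
A tree has no arcs besides those of its parent function: the latter already connect the ends of any further
arc by a path of length at least 2, which the arc would close to a cycle.
\<close>

lemma tree_arcs_eq:
  assumes T: "undirected_tree T" and r: "r \<in> pverts T" and f: "f \<in> forests (pverts T)"
    and par: "\<And>x. x \<in> pverts T - {r} \<Longrightarrow> (x, f x) \<in> parcs T \<and> f x \<noteq> x"
    and fr: "f r = r"
  shows "parcs T = parent_arcs (pverts T) f"
proof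
  have G: "pair_graph T" using T by (simp add: undirected_tree_def)
  note A = pair_graph_arcs[OF G]
  let ?S = "parent_arcs (pverts T) f"
  show ST: "?S \<subseteq> parcs T" by (rule parent_arcs_subset[where r = r]) (use A(3) fr par in auto)
  show "parcs T \<subseteq> ?S"
  proof (rule ccontr)
    assume "\<not> parcs T \<subseteq> ?S"
    then obtain u v where uv: "(u, v) \<in> parcs T" "(u, v) \<notin> ?S" by auto
    have V: "u \<in> pverts T" "v \<in> pverts T" and "u \<noteq> v" using uv A by (auto simp: irrefl_def)
    let ?T = "\<lparr>pverts = pverts T, parcs = ?S\<rparr>"
    interpret S: pair_wf_digraph ?T by unfold_locales (auto simp: parent_arcs_def)
    interpret T: pair_graph T by fact
    have "(v, r) \<in> ?S\<^sup>*" "(u, r) \<in> ?S\<^sup>*" using forest_reaches_root[OF f] par V by blast+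
    then have "(u, v) \<in> ?S\<^sup>*"
      using sym_rtrancl[OF sym_parent_arcs] by (meson rtrancl_trans symE)
    then have "u \<rightarrow>\<^sup>*\<^bsub>with_proj ?T\<^esub> v" using V by (simp add: S.reachable_conv)
    then obtain p where p: "S.apath u p v" by (auto simp: S.reachable_apath)
    then have pw: "set p \<subseteq> ?S" "pcas u p v" "distinct (pawalk_verts u p)"
      by (auto simp: S.apath_def S.awalk_def)
    have "p \<noteq> []" using pw \<open>u \<noteq> v\<close> by auto
    moreover have "p \<noteq> [e]" for e using pw uv by (cases e) auto
    ultimately have len: "2 \<le> length p" by (cases p; cases "tl p") auto
    have "T.awalk u p v" using pw ST V unfolding T.awalk_def by auto
    moreover have "T.awalk v [(v, u)] u"
      using uv(1) A(3) V by (auto simp: T.awalk_def sym_def)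
    ultimately have "T.awalk u (p @ [(v, u)]) u" by (rule T.awalk_appendI)
    moreover have "distinct (tl (pawalk_verts u (p @ [(v, u)])))"
    proof -
      have "pawalk_verts u (p @ [(v, u)]) = pawalk_verts u p @ [u]"
        by (rule pawalk_verts_snoc[OF pw(2)])
      moreover have "pawalk_verts u p = u # tl (pawalk_verts u p)" using pw(2) by (cases p) auto
      ultimately show ?thesis using pw(3) by (metis distinct.simps(2) distinct1_rotate list.sel(3)
          rotate1.simps(2) append_Cons)
    qed
    ultimately have "T.cycle (p @ [(v, u)])" unfolding T.cycle_def by blast
    moreover have "3 \<le> length (p @ [(v, u)])" using len by simp
    ultimately show False using T unfolding undirected_tree_def by blast
  qed
qed

lemma pcas_nth:
  assumes "pcas u p v" "i < length p"
  shows "p ! i = (pawalk_verts u p ! i, pawalk_verts u p ! Suc i)"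
  using assms
proof (induction p arbitrary: u i)
  case (Cons e p)
  then show ?case by (cases i; cases p) (auto simp: prod_eq_iff)
qed simp

lemma length_pawalk_verts: "length (pawalk_verts u p) = Suc (length p)"
  by (induction p arbitrary: u) auto

lemma pawalk_verts_last: "pcas u p v \<Longrightarrow> pawalk_verts u p ! length p = v"
  by (induction p arbitrary: u) auto

text \<open>
On a cycle, consider a vertex of maximal rank. Both of its neighbours on the cycle have smaller or equal rank, so
both are its parent, which is impossible on a cycle of length at least 3.
\<close>

lemma parent_arcs_tree:
  assumes fin: "finite V" and r: "r \<in> V" and f: "f \<in> forests V"
    and root: "\<And>x. x \<in> V - {r} \<Longrightarrow> f x \<noteq> x"
  shows "undirected_tree \<lparr>pverts = V, parcs = parent_arcs V f\<rparr>"
proof -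
  let ?T = "\<lparr>pverts = V, parcs = parent_arcs V f\<rparr>"
  have G: "pair_graph ?T"
    using fin sym_parent_arcs[of V f] by (intro pair_graphI) (auto simp: irrefl_def parent_arcs_def[of V f])
  interpret T: pair_graph ?T by fact
  from f obtain h :: "'a \<Rightarrow> nat" where
    h: "\<And>x. x \<in> V \<Longrightarrow> f x \<noteq> x \<Longrightarrow> h (f x) < h x" by (rule forestsE) blast
  have "(x, y) \<in> (parent_arcs V f)\<^sup>*" if "x \<in> V" "y \<in> V" for x y
  proof -
    have "(x, r) \<in> (parent_arcs V f)\<^sup>*" "(y, r) \<in> (parent_arcs V f)\<^sup>*"
      using forest_reaches_root[OF f root] that by blast+
    then show ?thesis using sym_rtrancl[OF sym_parent_arcs] by (meson rtrancl_trans symE)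
  qed
  then have "connected (with_proj ?T)" using r unfolding connected_with_proj[OF G] by auto
  moreover have "\<not> (pre_digraph.cycle (with_proj ?T) p \<and> 3 \<le> length p)" for p
  proof
    assume c: "pre_digraph.cycle (with_proj ?T) p \<and> 3 \<le> length p"
    then obtain u where sub: "set p \<subseteq> parent_arcs V f" and cas: "pcas u p u"
      and d: "distinct (tl (pawalk_verts u p))"
      unfolding T.cycle_def T.awalk_def by auto
    let ?k = "length p"
    define w where "w i = pawalk_verts u p ! i" for i
    have k: "3 \<le> ?k" using c by simp
    then have ne: "p \<noteq> []" by auto
    have arc: "(w i, w (Suc i)) \<in> parent_arcs V f" if "i < ?k" for i
      using pcas_nth[OF cas that] sub that unfolding w_def by (metis nth_mem subsetD)
    have w0: "w 0 = w ?k"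
    proof -
      have "pawalk_verts u p ! 0 = u" by (cases p) (use cas in auto)
      then show ?thesis using pawalk_verts_last[OF cas] by (simp add: w_def)
    qed
    have inj: "i = j" if "1 \<le> i" "i \<le> ?k" "1 \<le> j" "j \<le> ?k" "w i = w j" for i j
    proof -
      have "tl (pawalk_verts u p) ! (i - 1) = tl (pawalk_verts u p) ! (j - 1)"
        using that by (simp add: w_def nth_tl length_pawalk_verts)
      then have "i - 1 = j - 1" using d that by (subst (asm) nth_eq_iff_index_eq) (auto simp: length_pawalk_verts)
      then show ?thesis using that by simp
    qed
    obtain i where i: "i \<in> {1..?k}" and mx: "\<And>j. j \<in> {1..?k} \<Longrightarrow> h (w j) \<le> h (w i)"
    proof -
      have "Max ((\<lambda>j. h (w j)) ` {1..?k}) \<in> (\<lambda>j. h (w j)) ` {1..?k}" using k by (intro Max_in) auto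
      then obtain i where "i \<in> {1..?k}" "h (w i) = Max ((\<lambda>j. h (w j)) ` {1..?k})" by auto
      then show thesis by (intro that[of i]) auto
    qed
    define a where "a = (if i = 1 then ?k else i - 1)"
    define b where "b = (if i = ?k then 1 else i + 1)"
    have ab: "a \<in> {1..?k}" "b \<in> {1..?k}" "a \<noteq> b" using i k by (auto simp: a_def b_def)
    have "(w a, w i) \<in> parent_arcs V f"
      using arc[of "i - 1"] i w0 ne by (cases "i = 1") (auto simp: a_def)
    then have "w a \<in> V \<and> w i \<in> V \<and> w a \<noteq> w i \<and> (w i = f (w a) \<or> w a = f (w i))"
      unfolding parent_arcs_def mem_Collect_eq prod.case .
    then have wa: "w a \<in> V" "w a \<noteq> w i" "w i = f (w a) \<or> w a = f (w i)" by metis+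
    have "(w i, w b) \<in> parent_arcs V f"
      using arc[of i] arc[of 0] i w0 k ne by (auto simp: b_def)
    then have "w i \<in> V \<and> w b \<in> V \<and> w i \<noteq> w b \<and> (w b = f (w i) \<or> w i = f (w b))"
      unfolding parent_arcs_def mem_Collect_eq prod.case .
    then have wb: "w b \<in> V" "w b \<noteq> w i" "w i = f (w b) \<or> w b = f (w i)" by metis+
    have "w i \<noteq> f (w a)"
    proof
      assume e: "w i = f (w a)"
      then have "h (f (w a)) < h (w a)" using wa(2) by (intro h wa(1)) simp
      then show False using mx[OF ab(1)] e by simp
    qed
    moreover have "w i \<noteq> f (w b)"
    proof
      assume e: "w i = f (w b)"
      then have "h (f (w b)) < h (w b)" using wb(2) by (intro h wb(1)) simp
      then show False using mx[OF ab(2)] e by simp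
    qed
    ultimately have "w a = w b" using wa wb by metis
    then show False using inj[of a b] ab by auto
  qed
  ultimately show ?thesis unfolding undirected_tree_def using G by blast
qed

lemma finite_spanning_trees:
  assumes "pair_graph G"
  shows "finite {T. undirected_spanning_tree T G}"
proof -
  let ?f = "\<lambda>D. \<lparr>pverts = pverts G, parcs = D\<rparr>"
  have "{T. undirected_spanning_tree T G} \<subseteq> ?f ` Pow (parcs G)"
  proof
    fix T assume "T \<in> {T. undirected_spanning_tree T G}"
    then have "T = ?f (parcs T)" "parcs T \<subseteq> parcs G"
      by (auto simp: undirected_spanning_tree_def spanning_def subgraph_def)
    then show "T \<in> ?f ` Pow (parcs G)" by blast
  qed
  moreover have "finite (?f ` Pow (parcs G))" using pair_graph_arcs[OF assms] by simp
  ultimately show ?thesis by (rule finite_subset)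
qed

lemma num_spanning_trees_pos:
  assumes G: "pair_graph G" and r: "r \<in> pverts G"
    and reach: "\<And>x. x \<in> pverts G \<Longrightarrow> (x, r) \<in> (parcs G)\<^sup>*"
  shows "0 < num_spanning_trees G"
proof -
  note A = pair_graph_arcs[OF G]
  obtain f where f: "f \<in> forests (pverts G)" "f r = r"
    "\<And>x. x \<in> pverts G - {r} \<Longrightarrow> (x, f x) \<in> parcs G \<and> f x \<noteq> x"
    using parent_function_exists[OF r A(5) reach] by blast
  let ?T = "\<lparr>pverts = pverts G, parcs = parent_arcs (pverts G) f\<rparr>"
  have tree: "undirected_tree ?T" by (rule parent_arcs_tree[OF A(1) r f(1)]) (use f in auto)
  have "parent_arcs (pverts G) f \<subseteq> parcs G"
    by (rule parent_arcs_subset[where r = r]) (use A(3) f in auto)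
  moreover have "wf_digraph (with_proj G)" "wf_digraph (with_proj ?T)"
    using G tree unfolding undirected_tree_def wf_digraph_wp_iff
    by (auto simp: pair_graph_def pair_digraph_def pair_fin_digraph_def)
  ultimately have "undirected_spanning_tree ?T G"
    using tree by (simp add: undirected_spanning_tree_def spanning_def subgraph_def compatibleI_with_proj)
  then show ?thesis
    unfolding num_spanning_trees_def using finite_spanning_trees[OF G] by (auto simp: card_gt_0_iff)
qed

text \<open>
A spanning tree with a chosen root \<open>r\<close> is a forest with the single root \<open>r\<close>; the forests with several
roots only increase the right-hand side.
\<close>

lemma num_spanning_trees_le_forest_sum:
  assumes G: "pair_graph G" and z: "0 < z"
  shows "real (card (pverts G)) * real (num_spanning_trees G) * z
    \<le> forest_sum (pverts G) (rooted z (adj (parcs G)))"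
proof -
  let ?V = "pverts G" and ?E = "parcs G"
  note A = pair_graph_arcs[OF G]
  let ?ST = "{T. undirected_spanning_tree T G}"
  define good where "good T r f \<longleftrightarrow> f \<in> forests ?V \<and> f r = r \<and>
     (\<forall>x\<in>?V - {r}. (x, f x) \<in> parcs T \<and> f x \<noteq> x)" for T :: "'a pair_pre_digraph" and r f
  have ST: "undirected_tree T" "pverts T = ?V" "parcs T \<subseteq> ?E" "pair_graph T" if "T \<in> ?ST" for T
    using that by (auto simp: undirected_spanning_tree_def spanning_def subgraph_def undirected_tree_def)
  have "\<exists>f. good T r f" if T: "T \<in> ?ST" and r: "r \<in> ?V" for T r
  proof -
    have "(x, r) \<in> (parcs T)\<^sup>*" if "x \<in> ?V" for x
      using ST[OF T] that r connected_with_proj[of T] by (auto simp: undirected_tree_def)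
    moreover have "parcs T \<subseteq> ?V \<times> ?V" using ST[OF T] A by blast
    ultimately show ?thesis
      using parent_function_exists[OF r, of "parcs T"] unfolding good_def by metis
  qed
  then obtain F where F: "\<And>T r. T \<in> ?ST \<Longrightarrow> r \<in> ?V \<Longrightarrow> good T r (F T r)" by metis
  let ?\<Phi> = "\<lambda>(T, r). F T r"
  have inj: "inj_on ?\<Phi> (?ST \<times> ?V)"
  proof (rule inj_onI, clarify)
    fix T r T' r'
    assume T: "undirected_spanning_tree T G" and T': "undirected_spanning_tree T' G"
      and r: "r \<in> ?V" and r': "r' \<in> ?V" and e: "F T r = F T' r'"
    have g: "good T r (F T r)" "good T' r' (F T r)" using F[of T r] F[of T' r'] T T' r r' e by auto
    then have "r = r'" using r by (auto simp: good_def)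
    have "parcs T = parent_arcs ?V (F T r)"
      using tree_arcs_eq[of T r "F T r"] ST[of T] T r g by (auto simp: good_def)
    moreover have "parcs T' = parent_arcs ?V (F T r)"
      using tree_arcs_eq[of T' r' "F T r"] ST[of T'] T' r' g by (auto simp: good_def)
    ultimately have "T = T'" using ST(2)[of T] ST(2)[of T'] T T' by simp
    then show "T = T' \<and> r = r'" using \<open>r = r'\<close> by simp
  qed
  let ?W = "\<lambda>f. \<Prod>x\<in>?V. rooted z (adj ?E) x (f x)"
  have W: "?W f = z" if f: "f \<in> ?\<Phi> ` (?ST \<times> ?V)" for f
  proof -
    obtain T r where T: "T \<in> ?ST" and r: "r \<in> ?V" and fTr: "f = F T r" using f by auto
    then have g: "good T r f" using F by simp
    have "?W f = rooted z (adj ?E) r (f r) * (\<Prod>x\<in>?V - {r}. rooted z (adj ?E) x (f x))"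
      by (rule prod.remove[OF A(1) r])
    also have "(\<Prod>x\<in>?V - {r}. rooted z (adj ?E) x (f x)) = 1"
    proof (rule prod.neutral, rule ballI)
      fix x assume "x \<in> ?V - {r}"
      then have "(x, f x) \<in> ?E" "f x \<noteq> x" using g ST(3)[OF T] by (auto simp: good_def)
      then show "rooted z (adj ?E) x (f x) = 1" by (auto simp: rooted_def adj_def)
    qed
    finally show ?thesis using g by (simp add: good_def rooted_def)
  qed
  have "real (card ?V) * real (num_spanning_trees G) * z = (\<Sum>f\<in>?\<Phi> ` (?ST \<times> ?V). z)"
    using card_image[OF inj] by (simp add: card_cartesian_product num_spanning_trees_def)
  also have "\<dots> = sum ?W (?\<Phi> ` (?ST \<times> ?V))" by (intro sum.cong refl) (simp add: W)
  also have "\<dots> \<le> forest_sum ?V (rooted z (adj ?E))"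
    unfolding forest_sum_def
  proof (rule sum_mono2)
    show "finite (forests ?V)" by (rule finite_forests[OF A(1)])
    show "?\<Phi> ` (?ST \<times> ?V) \<subseteq> forests ?V" using F by (force simp: good_def)
  qed (use z in \<open>auto intro!: prod_nonneg rooted_adj_nonneg\<close>)
  finally show ?thesis .
qed

section \<open>Joins of three graphs\<close>

definition join3 :: "'a rel \<Rightarrow> 'a set \<Rightarrow> 'a set \<Rightarrow> 'a set \<Rightarrow> bool" where
  "join3 E A B C \<longleftrightarrow> finite A \<and> finite B \<and> finite C \<and> A \<noteq> {} \<and> B \<noteq> {} \<and> C \<noteq> {} \<and>
     A \<inter> B = {} \<and> A \<inter> C = {} \<and> B \<inter> C = {} \<and> sym E \<and> irrefl E \<and>
     A \<times> B \<subseteq> E \<and> A \<times> C \<subseteq> E \<and> B \<times> C \<subseteq> E"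

definition block :: "'a rel \<Rightarrow> 'a set \<Rightarrow> real \<Rightarrow> real" where
  "block E X y = forest_sum X (rooted y (adj E)) / y"

text \<open>
For a join of three graphs this is the number of spanning trees; \<open>block E X y\<close> is \<open>t\<^sub>X(y)\<close> in the notation above.
\<close>

definition tree_number :: "'a rel \<Rightarrow> 'a set \<Rightarrow> 'a set \<Rightarrow> 'a set \<Rightarrow> real" where
  "tree_number E A B C = real (card A + card B + card C)
     * block E A (real (card B + card C)) * block E B (real (card A + card C))
     * block E C (real (card A + card B))"

definition orientation_product :: "'a set \<Rightarrow> 'a rel \<Rightarrow> real" where
  "orientation_product U E = real (card (ranked U E)) * real (card (strong U E))"

lemma join3_swap:
  assumes "join3 E A B C"
  shows "join3 E B A C" "join3 E C A B" "tree_number E B A C = tree_number E A B C"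
    "tree_number E C A B = tree_number E A B C"
proof -
  have "Y \<times> X \<subseteq> E" if "X \<times> Y \<subseteq> E" "sym E" for X Y using that by (auto simp: sym_def)
  then have "B \<times> A \<subseteq> E" "C \<times> A \<subseteq> E" "C \<times> B \<subseteq> E" using assms by (simp_all add: join3_def)
  then show "join3 E B A C" "join3 E C A B" using assms by (simp_all add: join3_def Int_commute)
  show "tree_number E B A C = tree_number E A B C" "tree_number E C A B = tree_number E A B C"
    by (simp_all add: tree_number_def ac_simps)
qed

lemma card_join3: "join3 E A B C \<Longrightarrow> card (A \<union> B \<union> C) = card A + card B + card C"
  by (simp add: join3_def card_Un_disjoint Int_Un_distrib2)

lemma block_nonneg: "0 \<le> y \<Longrightarrow> 0 \<le> block E X y"
  unfolding block_def by (intro divide_nonneg_nonneg forest_sum_nonneg rooted_adj_nonneg) auto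

lemma block_singleton: "0 < y \<Longrightarrow> block E {x} y = 1"
  using forest_sum_expand[of "{x}" x "rooted y (adj E)"] by (simp add: block_def rooted_def)

text \<open>
As a polynomial in \<open>y\<close>, \<open>block E X y\<close> has nonnegative coefficients and degree \<open>card X - 1\<close>.
\<close>

lemma block_step:
  assumes "finite X" "X \<noteq> {}" "0 < y'" "y' \<le> y"
  shows "block E X y \<le> (y / y') ^ (card X - 1) * block E X y'"
proof -
  have c: "card X = Suc (card X - 1)" using assms by (cases "card X") auto
  have "forest_sum X (rooted y (adj E)) \<le> (y / y') ^ card X * forest_sum X (rooted y' (adj E))"
    by (rule forest_sum_rooted_scale) (use assms in \<open>auto simp: adj_def\<close>)
  then have "block E X y \<le> (y / y') ^ card X * forest_sum X (rooted y' (adj E)) / y"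
    unfolding block_def using assms by (intro divide_right_mono) auto
  also have "\<dots> = (y / y') ^ (card X - 1) * block E X y'"
    unfolding block_def using assms by (subst c) (simp add: field_simps)
  finally show ?thesis .
qed

lemma orientation_product_delete:
  assumes J: "join3 E A B C" and v: "v \<in> A" and e: "e = card {u \<in> A - {v}. (v, u) \<in> E}"
    and s: "s = card B + card C"
  shows "real (s + e + 1) * (2 ^ (s + e) - 2) * orientation_product (A - {v} \<union> B \<union> C) E
    \<le> orientation_product (A \<union> B \<union> C) E"
proof -
  let ?U = "A \<union> B \<union> C"
  define N where "N = {u \<in> ?U - {v}. (v, u) \<in> E}"
  have fin: "finite ?U" and vU: "v \<in> ?U" and E: "sym E" "irrefl E"
    using J v by (auto simp: join3_def)
  have U: "?U - {v} = A - {v} \<union> B \<union> C" using J v by (auto simp: join3_def)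
  have "N = {u \<in> A - {v}. (v, u) \<in> E} \<union> (B \<union> C)" using J v by (auto simp: join3_def N_def)
  moreover have "card ({u \<in> A - {v}. (v, u) \<in> E} \<union> (B \<union> C)) = e + card (B \<union> C)"
    unfolding e by (rule card_Un_disjoint) (use J in \<open>auto simp: join3_def\<close>)
  moreover have "card (B \<union> C) = s"
    unfolding s by (rule card_Un_disjoint) (use J in \<open>auto simp: join3_def\<close>)
  ultimately have N: "card N = s + e" by simp
  have "card B \<noteq> 0" "card C \<noteq> 0" using J by (auto simp: join3_def)
  then have s2: "2 \<le> s" unfolding s by linarith
  have "(2::real) ^ 1 \<le> 2 ^ (s + e)" using s2 by (intro power_increasing) auto
  moreover have "(2::nat) \<le> 2 ^ (s + e)" using s2 power_increasing[of 1 "s + e" "2::nat"] by simp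
  ultimately have pw: "real (2 ^ (s + e) - 2) = 2 ^ (s + e) - 2" by (simp add: of_nat_diff)
  have r: "real (s + e + 1) * real (card (ranked (?U - {v}) E)) \<le> real (card (ranked ?U E))"
    using card_ranked_delete[OF fin vU E N_def] unfolding N of_nat_mult[symmetric] by (intro of_nat_mono)
  have t: "(2 ^ (s + e) - 2) * real (card (strong (?U - {v}) E)) \<le> real (card (strong ?U E))"
    using card_strong_delete[OF fin vU E N_def] unfolding N pw[symmetric] of_nat_mult[symmetric]
    by (intro of_nat_mono)
  have "(real (s + e + 1) * real (card (ranked (?U - {v}) E)))
      * ((2 ^ (s + e) - 2) * real (card (strong (?U - {v}) E))) \<le> orientation_product ?U E"
    unfolding orientation_product_def
    by (intro mult_mono r t) (use \<open>(2::real) ^ 1 \<le> 2 ^ (s + e)\<close> in auto)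
  then show ?thesis unfolding U orientation_product_def by (simp add: mult_ac)
qed

text \<open>
The argument \<open>b + c\<close> of the block of \<open>A\<close> does not change, while those of \<open>B\<close> and \<open>C\<close> drop by 1.
\<close>

lemma tree_number_delete:
  fixes \<phi> :: real
  assumes J: "join3 E A B C" and v: "v \<in> A" and ne: "A - {v} \<noteq> {}"
    and a: "a = card A" and b: "b = card B" and c: "c = card C"
    and \<phi>: "forest_sum A (rooted (real (b + c)) (adj E)) \<le> \<phi> * forest_sum (A - {v}) (rooted (real (b + c)) (adj E))"
  shows "(real (a + b + c) - 1) * tree_number E A B C \<le> real (a + b + c) * (\<phi>
      * (real (a + c) / (real (a + c) - 1)) ^ (b - 1) * (real (a + b) / (real (a + b) - 1)) ^ (c - 1))
      * tree_number E (A - {v}) B C"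
proof -
  have fin: "finite A" "finite B" "finite C" and neBC: "B \<noteq> {}" "C \<noteq> {}"
    using J by (auto simp: join3_def)
  have pos: "1 \<le> b" "1 \<le> c" unfolding b c using fin neBC by (simp_all add: Suc_le_eq card_gt_0_iff)
  have cA: "card (A - {v}) = a - 1" using v a by simp
  have "1 \<le> a - 1" using ne fin cA by (metis One_nat_def Suc_leI card_gt_0_iff finite_Diff)
  then have a2: "2 \<le> a" by simp
  have A: "block E A (real (b + c)) \<le> \<phi> * block E (A - {v}) (real (b + c))"
    unfolding block_def using divide_right_mono[OF \<phi>, of "real (b + c)"] by simp
  have B: "block E B (real (a + c)) \<le>
      (real (a + c) / (real (a + c) - 1)) ^ (b - 1) * block E B (real (a + c) - 1)"
    using block_step[OF fin(2) neBC(1), of "real (a + c) - 1" "real (a + c)" E] a2 b by simp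
  have C: "block E C (real (a + b)) \<le>
      (real (a + b) / (real (a + b) - 1)) ^ (c - 1) * block E C (real (a + b) - 1)"
    using block_step[OF fin(3) neBC(2), of "real (a + b) - 1" "real (a + b)" E] a2 c by simp
  have sub: "real (a - 1 + c) = real (a + c) - 1" "real (a - 1 + b) = real (a + b) - 1"
    "real (a - 1 + b + c) = real (a + b + c) - 1" using a2 by (simp_all add: of_nat_diff)
  have bn: "0 \<le> block E A (real (b + c))" "0 \<le> block E B (real (a + c))" "0 \<le> block E C (real (a + b))"
    "0 \<le> block E B (real (a + c) - 1)" "0 \<le> block E C (real (a + b) - 1)"
    using a2 by (auto intro!: block_nonneg)
  have AB: "block E A (real (b + c)) * block E B (real (a + c))
      \<le> (\<phi> * block E (A - {v}) (real (b + c)))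
         * ((real (a + c) / (real (a + c) - 1)) ^ (b - 1) * block E B (real (a + c) - 1))"
    by (rule mult_mono[OF A B _ bn(2)]) (use A bn in linarith)
  have "block E A (real (b + c)) * block E B (real (a + c)) * block E C (real (a + b))
      \<le> (\<phi> * block E (A - {v}) (real (b + c)))
         * ((real (a + c) / (real (a + c) - 1)) ^ (b - 1) * block E B (real (a + c) - 1))
         * ((real (a + b) / (real (a + b) - 1)) ^ (c - 1) * block E C (real (a + b) - 1))"
    by (rule mult_mono[OF AB C _ bn(3)]) (use AB mult_nonneg_nonneg[OF bn(1,2)] in linarith)
  then have "(real (a + b + c) * (real (a + b + c) - 1)) *
      (block E A (real (b + c)) * block E B (real (a + c)) * block E C (real (a + b)))
      \<le> (real (a + b + c) * (real (a + b + c) - 1)) *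
       ((\<phi> * block E (A - {v}) (real (b + c)))
         * ((real (a + c) / (real (a + c) - 1)) ^ (b - 1) * block E B (real (a + c) - 1))
         * ((real (a + b) / (real (a + b) - 1)) ^ (c - 1) * block E C (real (a + b) - 1)))"
    using a2 by (intro mult_left_mono mult_nonneg_nonneg) auto
  then show ?thesis
    unfolding tree_number_def cA a[symmetric] b[symmetric] c[symmetric] sub by (simp only: mult_ac)
qed

text \<open>
The hypothesis \<open>num\<close> is what remains of the induction step after the factor \<open>n / (n - 1)\<close> in the number
of trees has cancelled against the one in \<open>beta\<close>.
\<close>

lemma orientation_bound_step:
  fixes \<phi> \<kappa> \<kappa>' :: real
  assumes J: "join3 E A B C" and v: "v \<in> A" and ne: "A - {v} \<noteq> {}"
    and a: "a = card A" and b: "b = card B" and c: "c = card C" and n: "n = a + b + c" "5 \<le> n"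
    and e: "e = card {u \<in> A - {v}. (v, u) \<in> E}"
    and \<phi>: "forest_sum A (rooted (real (b + c)) (adj E))
               \<le> \<phi> * forest_sum (A - {v}) (rooted (real (b + c)) (adj E))" "0 \<le> \<phi>"
    and \<psi>: "\<psi> = (real (a + c) / (real (a + c) - 1)) ^ (b - 1) * (real (a + b) / (real (a + b) - 1)) ^ (c - 1)"
    and \<kappa>: "0 \<le> \<kappa>"
    and num: "\<kappa> * (3 / 2) * (\<phi> * \<psi>)\<^sup>2 \<le> \<kappa>' * (real (b + c + e + 1) * (2 ^ (b + c + e) - 2))"
    and IH: "\<kappa>' * beta (n - 1) * (tree_number E (A - {v}) B C)\<^sup>2
               \<le> orientation_product (A - {v} \<union> B \<union> C) E"
  shows "\<kappa> * beta n * (tree_number E A B C)\<^sup>2 \<le> orientation_product (A \<union> B \<union> C) E"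
proof -
  let ?T = "tree_number E A B C" and ?T' = "tree_number E (A - {v}) B C"
  let ?D = "real (b + c + e + 1) * (2 ^ (b + c + e) - 2)"
  have npos: "0 < real n" "0 < real n - 1" using n by simp_all
  have Tnn: "0 \<le> ?T" unfolding tree_number_def by (intro mult_nonneg_nonneg block_nonneg) auto
  have bnn: "0 \<le> beta (n - 1)" by (simp add: beta_def)
  have D: "0 \<le> ?D"
  proof -
    have "1 \<le> b" using J b by (auto simp: join3_def Suc_le_eq card_gt_0_iff)
    then have "(2::real) ^ 1 \<le> 2 ^ (b + c + e)" by (intro power_increasing) auto
    then show ?thesis by simp
  qed
  have "(real n - 1) * ?T \<le> real n * (\<phi> * \<psi>) * ?T'"
    using tree_number_delete[OF J v ne a b c \<phi>(1)] n \<psi> by (simp add: mult_ac)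
  then have "((real n - 1) * ?T)\<^sup>2 \<le> (real n * (\<phi> * \<psi>) * ?T')\<^sup>2"
    using npos Tnn by (intro power_mono) auto
  then have sq: "(real n - 1)\<^sup>2 * ?T\<^sup>2 \<le> (real n)\<^sup>2 * ((\<phi> * \<psi>)\<^sup>2 * ?T'\<^sup>2)"
    by (simp add: power_mult_distrib mult_ac)
  have beta: "beta n * (real n)\<^sup>2 = 3 / 2 * beta (n - 1) * (real n - 1)\<^sup>2"
    using beta_step[OF n(2)] n(2) by (simp add: of_nat_diff)
  have bn: "beta n = 3 / 2 * beta (n - 1) * (real n - 1)\<^sup>2 / (real n)\<^sup>2"
    using beta npos by (simp add: field_simps)
  have "\<kappa> * beta n * ?T\<^sup>2 = (\<kappa> * (3 / 2) * beta (n - 1) / (real n)\<^sup>2) * ((real n - 1)\<^sup>2 * ?T\<^sup>2)"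
    unfolding bn by simp
  also have "\<dots> \<le> (\<kappa> * (3 / 2) * beta (n - 1) / (real n)\<^sup>2) * ((real n)\<^sup>2 * ((\<phi> * \<psi>)\<^sup>2 * ?T'\<^sup>2))"
    by (rule mult_left_mono[OF sq]) (use \<kappa> bnn in auto)
  also have "\<dots> = (\<kappa> * (3 / 2) * (\<phi> * \<psi>)\<^sup>2) * (beta (n - 1) * ?T'\<^sup>2)"
    using npos by simp
  also have "\<dots> \<le> (\<kappa>' * ?D) * (beta (n - 1) * ?T'\<^sup>2)"
    by (rule mult_right_mono[OF num]) (use bnn in auto)
  also have "\<dots> = ?D * (\<kappa>' * beta (n - 1) * ?T'\<^sup>2)" by (simp add: mult_ac)
  also have "\<dots> \<le> ?D * orientation_product (A - {v} \<union> B \<union> C) E" by (rule mult_left_mono[OF IH D])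
  also have "\<dots> \<le> orientation_product (A \<union> B \<union> C) E"
    using orientation_product_delete[OF J v e] b c by simp
  finally show ?thesis .
qed

lemma card_ranked_insert:
  assumes "finite U" "v \<notin> U" "sym E" "irrefl E" "k \<le> card {u \<in> U. (v, u) \<in> E}" "m \<le> card (ranked U E)"
  shows "(k + 1) * m \<le> card (ranked (insert v U) E)"
proof -
  have U: "insert v U - {v} = U" using assms by simp
  have "(k + 1) * m \<le> (card {u \<in> U. (v, u) \<in> E} + 1) * card (ranked U E)"
    using assms by (intro mult_mono) auto
  also have "\<dots> \<le> card (ranked (insert v U) E)"
    using card_ranked_delete[of "insert v U" v E "{u \<in> U. (v, u) \<in> E}"] assms unfolding U by simp
  finally show ?thesis .
qed

lemma card_ranked_triangle:
  assumes d: "distinct [x, y, p]" and E: "sym E" "irrefl E"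
    and arcs: "(x, y) \<in> E" "(x, p) \<in> E" "(y, p) \<in> E"
  shows "6 \<le> card (ranked {x, y, p} E)"
proof -
  have s: "(y, x) \<in> E" "(p, x) \<in> E" "(p, y) \<in> E" using arcs E by (auto simp: sym_def)
  have "(0 + 1) * 1 \<le> card (ranked {p} E)"
    by (rule card_ranked_insert) (use E card_ranked_empty[of E] in auto)
  then have "(1 + 1) * 1 \<le> card (ranked {y, p} E)"
  proof (intro card_ranked_insert)
    have "{u \<in> {p}. (y, u) \<in> E} = {p}" using arcs by auto
    then show "1 \<le> card {u \<in> {p}. (y, u) \<in> E}" by simp
  qed (use d E in auto)
  then have "(2 + 1) * 2 \<le> card (ranked {x, y, p} E)"
  proof (intro card_ranked_insert)
    have "{u \<in> {y, p}. (x, u) \<in> E} = {y, p}" using arcs by auto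
    then show "2 \<le> card {u \<in> {y, p}. (x, u) \<in> E}" using d by simp
  qed (use d E in auto)
  then show ?thesis by simp
qed

text \<open>
The two graphs are \<open>K\<^sub>4\<close> and \<open>K\<^sub>4\<close> minus the edge \<open>pq\<close>. For the latter, \<open>18 * 6 / 8\<^sup>2 = 27 / 16\<close> is
exactly \<open>beta 4\<close>.
\<close>

lemma orientation_bound_four:
  assumes J: "join3 E A B C" and A: "card A = 2" and B: "card B = 1" and C: "card C = 1"
  shows "beta 4 * (tree_number E A B C)\<^sup>2 \<le> orientation_product (A \<union> B \<union> C) E"
proof -
  obtain p q where pq: "A = {p, q}" "p \<noteq> q" using A by (auto simp: card_2_iff)
  obtain x where x: "B = {x}" using B by (auto simp: card_1_singleton_iff)
  obtain y where y: "C = {y}" using C by (auto simp: card_1_singleton_iff)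
  have E: "sym E" "irrefl E" and d: "distinct [x, y, p, q]"
    using J pq x y by (auto simp: join3_def)
  have "(p, x) \<in> E" "(q, x) \<in> E" "(p, y) \<in> E" "(q, y) \<in> E" "(x, y) \<in> E"
    using J pq x y by (auto simp: join3_def)
  then have arcs: "(x, y) \<in> E" "(x, p) \<in> E" "(x, q) \<in> E" "(y, p) \<in> E" "(y, q) \<in> E"
    "(p, x) \<in> E" "(q, x) \<in> E" "(p, y) \<in> E" "(q, y) \<in> E" using E by (auto simp: sym_def)
  have U: "A \<union> B \<union> C = {x, y, p, q}" "insert q {x, y, p} = {x, y, p, q}" using pq x y by auto
  define t where "t = (if (p, q) \<in> E then 1 else 0 :: nat)"
  have st: "(if (p, q) \<in> E then 24 else 6) \<le> card (strong {x, y, p, q} E)"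
    by (rule card_strong_four[OF d E]) (use arcs in auto)
  have "(2 + t + 1) * 6 \<le> card (ranked (insert q {x, y, p}) E)"
  proof (rule card_ranked_insert)
    show "6 \<le> card (ranked {x, y, p} E)" by (rule card_ranked_triangle) (use d E arcs in auto)
    have "{u \<in> {x, y, p}. (q, u) \<in> E} = (if (p, q) \<in> E then {x, y, p} else {x, y})"
      using arcs E(1) by (auto simp: sym_def)
    then show "2 + t \<le> card {u \<in> {x, y, p}. (q, u) \<in> E}" using d by (auto simp: t_def)
  qed (use d E in auto)
  then have rk: "(2 + t + 1) * 6 \<le> card (ranked {x, y, p, q} E)" unfolding U .
  have "forest_sum A (rooted 2 (adj E)) = forest_sum A (rooted 2 (\<lambda>_ _. real t))"
    by (rule forest_sum_cong) (use pq E(1) in \<open>auto simp: rooted_def adj_def t_def sym_def\<close>)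
  also have "\<dots> = 2 * (2 + 2 * t)"
    using forest_sum_complete[of A 2 "\<lambda>_. real t"] pq by simp
  finally have "tree_number E A B C = 8 + 8 * t"
    using A by (simp add: tree_number_def x y block_singleton) (simp add: block_def)
  then have T: "beta 4 * (tree_number E A B C)\<^sup>2 = 27 / 16 * (8 + 8 * real t)\<^sup>2"
    by (simp add: beta_def)
  have "real ((2 + t + 1) * 6) * real (if (p, q) \<in> E then 24 else 6) \<le> orientation_product {x, y, p, q} E"
    unfolding orientation_product_def by (intro mult_mono of_nat_mono rk st) auto
  then show ?thesis unfolding T U(1) by (auto simp: t_def power2_eq_square split: if_splits)
qed

text \<open>
The deleted vertex \<open>v\<close> has minimum degree in \<open>G[A]\<close>. Then each neighbour of \<open>v\<close> in \<open>A\<close> has many further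
neighbours there, and is therefore rarely a root.
\<close>

lemma orientation_bound_two_dominating:
  assumes "join3 E A B C" "2 \<le> card A" "card B = 1" "card C = 1"
  shows "beta (card A + 2) * (tree_number E A B C)\<^sup>2 \<le> orientation_product (A \<union> B \<union> C) E"
  using assms
proof (induction "card A" arbitrary: A)
  case 0 then show ?case by simp
next
  case (Suc k)
  note J = Suc.prems(1) and B = Suc.prems(3) and C = Suc.prems(4)
  show ?case
  proof (cases "card A = 2")
    case True
    then show ?thesis using orientation_bound_four[OF J True B C] by simp
  next
    case False
    then have A3: "3 \<le> card A" using Suc.prems by simp
    have fin: "finite A" and E: "sym E" "irrefl E" using J by (auto simp: join3_def)
    define deg where "deg v = card {u \<in> A - {v}. (v, u) \<in> E}" for v
    have "A \<noteq> {}" using A3 by auto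
    then obtain v where v: "v \<in> A" and mn: "\<And>w. w \<in> A \<Longrightarrow> deg v \<le> deg w"
      using arg_min_if_finite[OF fin, of deg] by (metis not_le)
    let ?N = "{u \<in> A - {v}. (v, u) \<in> E}"
    define r where "r = 3 / (2 * (real (deg v) + 2))"
    define \<phi> where "\<phi> = 2 * (1 + r) ^ deg v + deg v * (1 + r) ^ (deg v - 1)"
    have r0: "0 < r" by (simp add: r_def)
    have cardA': "card (A - {v}) = card A - 1" using v by simp
    then have "card (A - {v}) \<noteq> 0" using A3 by linarith
    then have ne: "A - {v} \<noteq> {}" by force
    have J': "join3 E (A - {v}) B C" using J ne unfolding join3_def by blast
    have "beta (card (A - {v}) + 2) * (tree_number E (A - {v}) B C)\<^sup>2
        \<le> orientation_product (A - {v} \<union> B \<union> C) E"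
      by (rule Suc.hyps(1)[OF _ J' _ B C]) (use A3 cardA' Suc.hyps(2) in auto)
    then have IH: "1 * beta (card A + 2 - 1) * (tree_number E (A - {v}) B C)\<^sup>2
        \<le> orientation_product (A - {v} \<union> B \<union> C) E" using cardA' A3 by simp
    have F: "forest_sum A (rooted 2 (adj E)) \<le> \<phi> * forest_sum (A - {v}) (rooted 2 (adj E))"
      unfolding \<phi>_def deg_def
    proof (rule forest_sum_add_vertex[OF fin v E(1)])
      fix S x assume S: "S \<subseteq> ?N" and x: "x \<in> ?N - S"
      let ?K = "{u \<in> A - {v} - {x}. (x, u) \<in> E}"
      have "{u \<in> A - {x}. (x, u) \<in> E} = insert v ?K" using x v E(1) by (auto simp: sym_def)
      then have "deg x = Suc (card ?K)" unfolding deg_def using fin by simp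
      then have K: "deg v \<le> Suc (card ?K)" using mn[of x] x by auto
      have "(2 + card ?K * (2 / (2 + 1))) * forest_sum (A - {v}) (root_rows (insert x S) (rooted 2 (adj E)))
          \<le> forest_sum (A - {v}) (root_rows S (rooted 2 (adj E)))"
        by (rule forest_sum_root_rows_le) (use fin x in auto)
      moreover have "1 / r \<le> 2 + card ?K * (2 / (2 + 1))" using K by (simp add: r_def)
      moreover have "0 \<le> forest_sum (A - {v}) (root_rows (insert x S) (rooted 2 (adj E)))"
        by (rule forest_sum_nonneg) (simp add: root_rows_def rooted_adj_nonneg)
      ultimately have "1 / r * forest_sum (A - {v}) (root_rows (insert x S) (rooted 2 (adj E)))
          \<le> forest_sum (A - {v}) (root_rows S (rooted 2 (adj E)))"
        by (meson mult_right_mono order_trans)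
      then show "forest_sum (A - {v}) (root_rows (insert x S) (rooted 2 (adj E)))
          \<le> r * forest_sum (A - {v}) (root_rows S (rooted 2 (adj E)))"
        using r0 by (simp add: field_simps)
    qed (use r0 in auto)
    have num: "1 * (3 / 2) * (\<phi> * 1)\<^sup>2 \<le> 1 * (real (2 + deg v + 1) * (2 ^ (2 + deg v) - 2))"
      using vertex_factor_two[of "deg v"] unfolding \<phi>_def r_def by (simp add: add_ac)
    have "1 * beta (card A + 2) * (tree_number E A B C)\<^sup>2 \<le> orientation_product (A \<union> B \<union> C) E"
    proof (rule orientation_bound_step[OF J v ne refl refl refl _ _ refl _ _ refl _ _ IH])
      show "0 \<le> \<phi>" using r0 by (simp add: \<phi>_def)
    qed (use B C A3 F num in \<open>auto simp: deg_def add_ac\<close>)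
    then show ?thesis by simp
  qed
qed

text \<open>
Largest parts keep \<open>\<psi>\<close> small. The hypothesis \<open>IH\<close> covers the joins that arise by deleting one vertex of \<open>A\<close>.
\<close>

lemma orientation_bound_largest:
  assumes J: "join3 E A B C" and mx: "card B \<le> card A" "card C \<le> card A"
    and n: "n = card A + card B + card C" "4 \<le> n"
    and IH: "\<And>A'. join3 E A' B C \<Longrightarrow> card A' = card A - 1 \<Longrightarrow> 4 \<le> n - 1 \<Longrightarrow>
      kappa (n - 1) * beta (n - 1) * (tree_number E A' B C)\<^sup>2 \<le> orientation_product (A' \<union> B \<union> C) E"
  shows "kappa n * beta n * (tree_number E A B C)\<^sup>2 \<le> orientation_product (A \<union> B \<union> C) E"
proof -
  have fin: "finite A" "finite B" "finite C" and E: "sym E" "irrefl E"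
    and ne: "A \<noteq> {}" "B \<noteq> {}" "C \<noteq> {}" using J by (auto simp: join3_def)
  have pos: "1 \<le> card B" "1 \<le> card C" using fin ne by (simp_all add: Suc_le_eq card_gt_0_iff)
  have bnn: "0 \<le> beta n" by (simp add: beta_def)
  have kap: "0 < kappa n" "kappa n \<le> 1" by (simp_all add: kappa_def)
  show ?thesis
  proof (cases "card B = 1 \<and> card C = 1")
    case True
    then have "beta n * (tree_number E A B C)\<^sup>2 \<le> orientation_product (A \<union> B \<union> C) E"
      using orientation_bound_two_dominating[OF J] n by simp
    moreover have "kappa n * (beta n * (tree_number E A B C)\<^sup>2) \<le> 1 * (beta n * (tree_number E A B C)\<^sup>2)"
      using kap bnn by (intro mult_right_mono) auto
    ultimately show ?thesis by (simp add: mult.assoc)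
  next
    case False
    define a where "a = card A"
    define b where "b = card B"
    define c where "c = card C"
    define s where "s = b + c"
    have s3: "3 \<le> s" using False pos by (auto simp: s_def b_def c_def)
    have s2a: "s \<le> 2 * a" using mx by (simp add: s_def a_def b_def c_def)
    have n': "n = a + b + c" "n = a + s" "5 \<le> n" using n s3 s2a by (auto simp: a_def b_def c_def s_def)
    obtain v where v: "v \<in> A" using ne by auto
    have cA': "card (A - {v}) = card A - 1" using v by simp
    have "card (A - {v}) \<noteq> 0" using s3 s2a cA' by (simp add: a_def)
    then have neA: "A - {v} \<noteq> {}" by force
    have J': "join3 E (A - {v}) B C" using J neA by (auto simp: join3_def)
    define e where "e = card {u \<in> A - {v}. (v, u) \<in> E}"
    define \<phi> where "\<phi> = s * (1 + 1 / real s) ^ e + e * (1 + 1 / real s) ^ (e - 1)"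
    define \<psi> where "\<psi> = (real (a + c) / (real (a + c) - 1)) ^ (b - 1) * (real (a + b) / (real (a + b) - 1)) ^ (c - 1)"
    define Y where "Y = max s (a + 1)"
    define q where "q = real Y / (real Y - 1)"
    have F: "forest_sum A (rooted (real s) (adj E)) \<le> \<phi> * forest_sum (A - {v}) (rooted (real s) (adj E))"
      unfolding \<phi>_def e_def
    proof (rule forest_sum_add_vertex[OF fin(1) v E(1) _ _ refl])
      fix S x assume x: "x \<in> {u \<in> A - {v}. (v, u) \<in> E} - S"
      \<comment> \<open>Neighbours in \<open>A\<close> are not taken into account, which gives \<open>r = 1 / s\<close>.\<close>
      have "(real s + card ({} :: 'a set) * (real s / (real s + 1)))
          * forest_sum (A - {v}) (root_rows (insert x S) (rooted (real s) (adj E)))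
          \<le> forest_sum (A - {v}) (root_rows S (rooted (real s) (adj E)))"
        by (rule forest_sum_root_rows_le) (use fin x s3 in auto)
      then show "forest_sum (A - {v}) (root_rows (insert x S) (rooted (real s) (adj E)))
          \<le> 1 / real s * forest_sum (A - {v}) (root_rows S (rooted (real s) (adj E)))"
        using s3 by (simp add: field_simps)
    qed (use s3 in auto)
    have psi_le: "\<psi> \<le> q ^ (s - 2)"
    proof -
      have q1: "0 \<le> q" using s3 by (simp add: q_def Y_def)
      have le: "real m / (real m - 1) \<le> q" if "Y \<le> m" for m
      proof -
        have "2 \<le> Y" using s3 by (simp add: Y_def)
        then show ?thesis using that unfolding q_def by (simp add: field_simps)
      qed
      have Ym: "Y \<le> a + c" "Y \<le> a + b" using mx pos by (auto simp: Y_def s_def a_def b_def c_def)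
      have "\<psi> \<le> q ^ (b - 1) * q ^ (c - 1)"
        unfolding \<psi>_def using le[OF Ym(1)] le[OF Ym(2)] q1 Ym s3
        by (intro mult_mono power_mono) (auto simp: Y_def)
      also have "\<dots> = q ^ (b - 1 + (c - 1))" by (simp only: power_add)
      also have "b - 1 + (c - 1) = s - 2" using pos by (simp add: s_def b_def c_def)
      finally show ?thesis .
    qed
    have psi0: "0 \<le> \<psi>"
      unfolding \<psi>_def using pos ne fin by (intro mult_nonneg_nonneg zero_le_power divide_nonneg_nonneg)
        (auto simp: a_def b_def c_def)
    have "\<psi>\<^sup>2 \<le> (q ^ (s - 2))\<^sup>2" by (rule power_mono[OF psi_le psi0])
    also have "\<dots> = q ^ (2 * (s - 2))" by (simp only: power_mult[symmetric] mult.commute)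
    finally have psi: "\<psi>\<^sup>2 \<le> q ^ (2 * (s - 2))" .
    have "(real s)\<^sup>2 * (kappa n * (3 / 2) * (\<phi> * \<psi>)\<^sup>2)
        \<le> (real s)\<^sup>2 * (kappa (n - 1) * (real (s + e + 1) * (2 ^ (s + e) - 2)))"
    proof -
      have "(real s)\<^sup>2 * (kappa n * (3 / 2) * (\<phi> * \<psi>)\<^sup>2) = (kappa n * (3 / 2) * (real s)\<^sup>2 * \<phi>\<^sup>2) * \<psi>\<^sup>2"
        by (simp add: power_mult_distrib mult_ac)
      also have "\<dots> \<le> (kappa n * (3 / 2) * (real s)\<^sup>2 * \<phi>\<^sup>2) * q ^ (2 * (s - 2))"
        using kap by (intro mult_left_mono[OF psi]) auto
      also have "\<dots> = (kappa (a + s) * (3 / 2) * q ^ (2 * (s - 2)) * (real s)\<^sup>2) * \<phi>\<^sup>2"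
        by (simp add: n'(2) mult_ac)
      also have "\<dots> \<le> (kappa (a + s - 1) * (real (s + 1) * (2 ^ s - 2))) * \<phi>\<^sup>2"
        unfolding q_def by (intro mult_right_mono kappa_step[OF s3 s2a Y_def]) auto
      also have "\<dots> = kappa (n - 1) * (real (s + 1) * (2 ^ s - 2) * \<phi>\<^sup>2)"
        by (simp add: n'(2) mult_ac)
      also have "\<dots> \<le> kappa (n - 1) * (real (s + e + 1) * (2 ^ (s + e) - 2) * (real s)\<^sup>2)"
        unfolding \<phi>_def by (intro mult_left_mono vertex_factor_three[OF s3]) (simp add: kappa_def)
      finally show ?thesis by (simp add: mult_ac)
    qed
    then have num: "kappa n * (3 / 2) * (\<phi> * \<psi>)\<^sup>2 \<le> kappa (n - 1) * (real (b + c + e + 1) * (2 ^ (b + c + e) - 2))"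
      unfolding s_def[symmetric] by (rule mult_left_le_imp_le) (use s3 in simp)
    show ?thesis
    proof (rule orientation_bound_step[OF J v neA a_def b_def c_def n'(1,3) e_def
          F[unfolded s_def] _ \<psi>_def _ num])
      show "0 \<le> \<phi>" by (simp add: \<phi>_def)
      show "kappa (n - 1) * beta (n - 1) * (tree_number E (A - {v}) B C)\<^sup>2
          \<le> orientation_product (A - {v} \<union> B \<union> C) E"
        by (rule IH[OF J' cA']) (use n' in simp)
    qed (use kap in simp)
  qed
qed

lemma orientation_bound:
  assumes "join3 E A B C" "n = card A + card B + card C" "4 \<le> n"
  shows "kappa n * beta n * (tree_number E A B C)\<^sup>2 \<le> orientation_product (A \<union> B \<union> C) E"
  using assms
proof (induction n arbitrary: A B C rule: less_induct)
  case (less n)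
  have main: "kappa n * beta n * (tree_number E X Y Z)\<^sup>2 \<le> orientation_product (X \<union> Y \<union> Z) E"
    if "join3 E X Y Z" "n = card X + card Y + card Z" "card Y \<le> card X" "card Z \<le> card X" for X Y Z
  proof (rule orientation_bound_largest[OF that(1,3,4,2) less.prems(3)])
    fix X' assume X': "join3 E X' Y Z" "card X' = card X - 1" "4 \<le> n - 1"
    have "card X \<noteq> 0" using that(1) by (auto simp: join3_def)
    then show "kappa (n - 1) * beta (n - 1) * (tree_number E X' Y Z)\<^sup>2 \<le> orientation_product (X' \<union> Y \<union> Z) E"
      using X' that(2) less.prems(3) by (intro less.IH) auto
  qed
  note sw = join3_swap[OF less.prems(1)]
  consider "card B \<le> card A" "card C \<le> card A" | "card A \<le> card B" "card C \<le> card B"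
    | "card A \<le> card C" "card B \<le> card C" by linarith
  then show ?case
  proof cases
    case 1 then show ?thesis using main[OF less.prems(1,2)] by simp
  next
    case 2 then show ?thesis using main[OF sw(1)] less.prems(2) sw(3) by (simp add: Un_commute add_ac)
  next
    case 3
    then show ?thesis using main[OF sw(2)] less.prems(2) sw(4) by (simp add: Un_commute Un_left_commute add_ac)
  qed
qed

lemma orientation_bound_triangle:
  assumes J: "join3 E A B C" and n: "card A + card B + card C = 3"
  shows "(tree_number E A B C)\<^sup>2 < orientation_product (A \<union> B \<union> C) E"
proof -
  have "card A \<noteq> 0" "card B \<noteq> 0" "card C \<noteq> 0" using J by (auto simp: join3_def)
  then have "card A = 1" "card B = 1" "card C = 1" using n by linarith+
  then obtain x y p where xyp: "A = {x}" "B = {y}" "C = {p}" by (metis card_1_singletonE)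
  have E: "sym E" "irrefl E" "distinct [x, y, p]" "(x, y) \<in> E" "(x, p) \<in> E" "(y, p) \<in> E"
    using J xyp by (auto simp: join3_def)
  have U: "A \<union> B \<union> C = {x, y, p}" using xyp by auto
  have "tree_number E A B C = 3" by (simp add: tree_number_def xyp block_singleton)
  moreover have "real 6 * real 2 \<le> orientation_product {x, y, p} E"
    unfolding orientation_product_def
    by (intro mult_mono of_nat_mono card_ranked_triangle card_strong_triangle) (use E in auto)
  ultimately show ?thesis unfolding U by simp
qed

lemma isCont_forest_sum:
  "isCont (\<lambda>z. forest_sum X (rooted (z + k) a)) w"
proof -
  have "isCont (\<lambda>z. rooted (z + k) a x y) w" for x y
    by (cases "x = y") (simp_all add: rooted_def)
  then show ?thesis unfolding forest_sum_def by (intro continuous_intros)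
qed

text \<open>
The number of trees times \<open>n\<close> is the linear coefficient of the forest polynomial of \<open>G\<close>, so after
division by \<open>z\<close> the join formula is evaluated in the limit \<open>z \<rightarrow> 0\<close>.
\<close>

lemma num_spanning_trees_le_tree_number:
  assumes G: "pair_graph G" and J: "join3 (parcs G) A B C" and V: "pverts G = A \<union> B \<union> C"
  shows "real (num_spanning_trees G) \<le> tree_number (parcs G) A B C"
proof -
  let ?a = "adj (parcs G)"
  have fin: "finite A" "finite B" "finite C" and ne: "A \<noteq> {}" "B \<noteq> {}" "C \<noteq> {}"
    using J by (auto simp: join3_def)
  have pos: "1 \<le> card A" "1 \<le> card B" "1 \<le> card C" using fin ne by (simp_all add: Suc_le_eq card_gt_0_iff)
  define n where "n = real (card (A \<union> B \<union> C))"
  have n: "n = real (card A + card B + card C)" unfolding n_def card_join3[OF J] ..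
  define g where "g z = (z + n)\<^sup>2
       * (forest_sum A (rooted (z + (n - card A)) ?a) / (z + (n - card A)))
       * (forest_sum B (rooted (z + (n - card B)) ?a) / (z + (n - card B)))
       * (forest_sum C (rooted (z + (n - card C)) ?a) / (z + (n - card C)))" for z
  have cross: "?a x y = 1 \<and> ?a y x = 1" if "(x, y) \<in> A \<times> B \<union> A \<times> C \<union> B \<times> C" for x y
  proof -
    have "(x, y) \<in> parcs G" using J that by (auto simp: join3_def)
    moreover from this have "(y, x) \<in> parcs G" using J by (simp add: join3_def symD)
    ultimately show ?thesis by (simp add: adj_def)
  qed
  have le: "n * real (num_spanning_trees G) \<le> g z" if z: "0 < z" for z
  proof -
    have "n * real (num_spanning_trees G) * z \<le> forest_sum (A \<union> B \<union> C) (rooted z ?a)"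
      using num_spanning_trees_le_forest_sum[OF G z] unfolding V n_def by simp
    also have "\<dots> = z * g z"
      using forest_sum_join3[OF fin _ _ _ cross ne z n_def] J
      by (simp add: join3_def g_def add_diff_eq mult.assoc)
    finally show ?thesis using z by (simp add: mult.commute)
  qed
  have d: "n - card A = real (card B + card C)" "n - card B = real (card A + card C)"
    "n - card C = real (card A + card B)" by (simp_all add: n)
  have "isCont g 0"
    unfolding g_def by (intro continuous_intros isCont_forest_sum) (use pos d in auto)
  then have "(g \<longlongrightarrow> g 0) (at_right 0)"
    by (metis isCont_def filterlim_at_split)
  then have "n * real (num_spanning_trees G) \<le> g 0"
    by (rule tendsto_lowerbound) (auto simp: eventually_at_right_field intro!: exI[of _ 1] le)
  also have "g 0 = n * tree_number (parcs G) A B C"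
    unfolding g_def tree_number_def block_def d by (simp add: n power2_eq_square)
  finally show ?thesis using pos n by simp
qed

lemma num_spanning_trees_pos_join3:
  assumes G: "pair_graph G" and J: "join3 (parcs G) A B C" and V: "pverts G = A \<union> B \<union> C"
  shows "0 < num_spanning_trees G"
proof -
  obtain r q where r: "r \<in> A" and q: "q \<in> B" using J by (auto simp: join3_def)
  have arcs: "(x, r) \<in> parcs G" if "x \<in> B \<union> C" for x
    using J that r unfolding join3_def sym_def by auto
  show ?thesis
  proof (rule num_spanning_trees_pos[OF G])
    show "r \<in> pverts G" using r V by simp
    fix x assume "x \<in> pverts G"
    then consider "x \<in> A" | "x \<in> B \<union> C" using V by auto
    then show "(x, r) \<in> (parcs G)\<^sup>*"
    proof cases
      case 1
      then have "(x, q) \<in> parcs G" using J q by (auto simp: join3_def)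
      moreover have "(q, r) \<in> parcs G" using arcs q by simp
      ultimately show ?thesis by (meson r_into_rtrancl rtrancl_into_rtrancl)
    qed (use arcs in auto)
  qed
qed

text \<open>
Two components of the complement serve as \<open>A\<close> and \<open>B\<close>, and all remaining vertices as \<open>C\<close>; there are no
arcs of the complement between them.
\<close>

lemma join3_of_complement:
  assumes G: "pair_graph G" and comp: "3 \<le> num_components (complement_graph G)"
  obtains A B C where "join3 (parcs G) A B C" "pverts G = A \<union> B \<union> C"
proof -
  note a = pair_graph_arcs[OF G]
  let ?H = "complement_graph G"
  have HG: "pair_graph ?H"
    by (rule pair_graphI) (use a in \<open>auto simp: complement_graph_def sym_def irrefl_def\<close>)
  interpret H: pair_graph ?H by (rule HG)
  have Hv: "pverts ?H = pverts G" by (simp add: complement_graph_def)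
  have "3 \<le> card H.sccs_verts"
    using comp by (simp add: num_components_def H.card_sccs_verts)
  then obtain \<S> where "\<S> \<subseteq> H.sccs_verts" "card \<S> = 3" by (rule obtain_subset_with_card_n)
  then obtain S1 S2 S3 where S: "S1 \<in> H.sccs_verts" "S2 \<in> H.sccs_verts" "S3 \<in> H.sccs_verts"
    "S1 \<noteq> S2" "S1 \<noteq> S3" "S2 \<noteq> S3" by (auto simp: card_3_iff)
  have sub: "S \<subseteq> pverts G" "S \<noteq> {}" if "S \<in> H.sccs_verts" for S
    using H.sccs_verts_subsets[OF that] that Hv by (auto simp: H.in_sccs_verts_conv_reachable)
  have disj: "S1 \<inter> S2 = {}" "S1 \<inter> S3 = {}" "S2 \<inter> S3 = {}"
    using S by (auto dest: H.sccs_verts_disjoint)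
  have cross: "(u, w) \<in> parcs G" if "S \<in> H.sccs_verts" "u \<in> S" "w \<in> pverts G" "w \<notin> S" for S u w
  proof (rule ccontr)
    assume "(u, w) \<notin> parcs G"
    moreover have "u \<in> pverts G" "u \<noteq> w" using sub[OF that(1)] that by auto
    ultimately have "(u, w) \<in> parcs ?H" using that by (auto simp: complement_graph_def)
    moreover from this have "(w, u) \<in> parcs ?H" by (rule H.arcs_symmetric)
    ultimately have "u \<rightarrow>\<^sup>*\<^bsub>with_proj ?H\<^esub> w" "w \<rightarrow>\<^sup>*\<^bsub>with_proj ?H\<^esub> u"
      by (auto intro: H.reachable_adjI)
    then show False using that by (auto simp: H.in_sccs_verts_conv_reachable)
  qed
  let ?C = "pverts G - S1 - S2"
  have "join3 (parcs G) S1 S2 ?C"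
    unfolding join3_def
  proof (intro conjI)
    show "finite S1" "finite S2" "finite ?C"
      using finite_subset[OF sub(1)[OF S(1)] a(1)] finite_subset[OF sub(1)[OF S(2)] a(1)] a(1) by simp_all
    show "S1 \<noteq> {}" "S2 \<noteq> {}" using sub(2) S by blast+
    show "sym (parcs G)" "irrefl (parcs G)" by (rule a)+
    show "S1 \<inter> S2 = {}" "S1 \<inter> ?C = {}" "S2 \<inter> ?C = {}" using disj by auto
    show "?C \<noteq> {}" using sub[OF S(3)] disj by auto
    show "S1 \<times> S2 \<subseteq> parcs G" using cross[OF S(1)] sub[OF S(2)] disj by auto
    show "S1 \<times> ?C \<subseteq> parcs G" using cross[OF S(1)] by auto
    show "S2 \<times> ?C \<subseteq> parcs G" using cross[OF S(2)] by auto
  qed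
  moreover have "pverts G = S1 \<union> S2 \<union> ?C" using sub(1)[OF S(1)] sub(1)[OF S(2)] by auto
  ultimately show thesis by (rule that)
qed

theorem corollary3p6:
  fixes G :: "'a pair_pre_digraph" and n :: nat
  assumes "pair_graph G"
    and "card (pverts G) = n"
    and "num_components (complement_graph G) \<ge> 3"
  shows "Q G > 1 \<and> (n \<ge> 16 \<longrightarrow> Q G \<ge> 27 / (real n)\<^sup>2 * (3 / 2) ^ (n - 4))"
proof -
  let ?E = "parcs G"
  obtain A B C where J: "join3 ?E A B C" and V: "pverts G = A \<union> B \<union> C"
    using join3_of_complement[OF assms(1,3)] by blast
  define T where "T = tree_number ?E A B C"
  define W where "W = real (num_acyclic_orientations G) * real (num_totally_cyclic_orientations G)"
  define \<tau> where "\<tau> = real (num_spanning_trees G)"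
  have n: "n = card A + card B + card C" using assms(2) card_join3[OF J] V by simp
  have tau: "0 < \<tau>" "\<tau> \<le> T"
    using num_spanning_trees_pos_join3[OF assms(1) J V] num_spanning_trees_le_tree_number[OF assms(1) J V]
    by (simp_all add: \<tau>_def T_def)
  then have tau2: "0 < \<tau>\<^sup>2" "\<tau>\<^sup>2 \<le> T\<^sup>2" by (auto intro: power_mono)
  have W: "orientation_product (pverts G) ?E \<le> W"
    unfolding W_def orientation_product_def
    by (intro mult_mono of_nat_mono card_ranked_le_num_acyclic_orientations[OF assms(1)]
        card_strong_le_num_totally_cyclic_orientations[OF assms(1)]) auto
  have Q: "Q G = W / \<tau>\<^sup>2" by (simp add: Q_def W_def \<tau>_def)
  have bound: "k \<le> Q G" if "0 \<le> k" "k * T\<^sup>2 \<le> orientation_product (pverts G) ?E" for k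
  proof -
    have "k * \<tau>\<^sup>2 \<le> k * T\<^sup>2" using that(1) tau2(2) by (rule mult_left_mono[rotated])
    then have "k * \<tau>\<^sup>2 \<le> W" using that(2) W by linarith
    then show ?thesis unfolding Q using tau2(1) by (simp add: pos_le_divide_eq)
  qed
  have "card A \<noteq> 0" "card B \<noteq> 0" "card C \<noteq> 0" using J by (auto simp: join3_def)
  then have "3 \<le> n" unfolding n by linarith
  show ?thesis
  proof (cases "n = 3")
    case True
    then have "T\<^sup>2 < W" using orientation_bound_triangle[OF J] n W V by (simp add: T_def)
    then have "\<tau>\<^sup>2 < W" using tau2 by linarith
    then show ?thesis unfolding Q using tau2(1) True by (simp add: pos_less_divide_eq)
  next
    case False
    then have n4: "4 \<le> n" using \<open>3 \<le> n\<close> by simp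
    have "kappa n * beta n \<le> Q G"
      by (rule bound) (use orientation_bound[OF J n n4] V kappa_beta_gt_1[OF n4] in \<open>simp_all add: T_def\<close>)
    moreover have "1 < kappa n * beta n" by (rule kappa_beta_gt_1[OF n4])
    moreover have "kappa n = 1" if "16 \<le> n" using that by (simp add: kappa_def)
    ultimately show ?thesis by (auto simp: beta_def)
  qed
qed

end
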